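(* Let $\varphi:M_m(\mathbb C)\to M_n(\mathbb C)$ be a hermiticity-preserving linear map whose Choi matrix $C\in M_n(\mathbb C)\otimes M_m(\mathbb C)\cong M_{nm}(\mathbb C)$ has tracially well behaved eigenspaces. Then the random variables $\hat x\otimes C$ and $ff^*$ in $\mathcal A\otimes M_{nm}(\mathbb C)$ are free with amalgamation over the commutative unital algebra $\mathcal B=\langle p_m,p_n\rangle\otimes\langle C\rangle$ generated by the projections $p_m,p_n$ and the matrix $C$.
   Context: Setting. $(\mathcal A,\tau)$ is a $C^*$-probability space with tracial state $\tau$, containing a unital copy of $M_{m+n}(\mathbb C)$ with matrix units $(e_{ij})_{i,j=1}^{m+n}$ and $\tau(e_{ij})=\delta_{ij}/(m+n)$. Put $p_m=\sum_{i=1}^me_{ii}$, $p_n=\sum_{i=m+1}^{m+n}e_{ii}$, and let $\psi:\mathcal A\to\langle p_m,p_n\rangle$, $\psi(a)=\tau(p_m)^{-1}\tau(p_ma)p_m+\tau(p_n)^{-1}\tau(p_na)p_n$, be the $\tau$-preserving conditional expectation. $\hat x=\hat x^*\in\mathcal A$ satisfies $\hat x=p_m\hat xp_m$, and $\hat x$ and $\{e_{ij}\}_{i,j\le m+n}$ are free with amalgamation over $\langle p_m,p_n\rangle$ with respect to $\psi$. Choi matrix and $f$. $E_i$ is the standard basis, $E_{ij}$ the matrix units, and $C=\sum_{i,j=1}^m\varphi(E_{ij})\otimes E_{ij}$, which is self-adjoint. Fix an orthonormal eigenbasis $v_1,\dots,v_{mn}$ of $C$ in $\mathbb C^n\otimes\mathbb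 C^m$ with eigenvalues $\lambda_1,\dots,\lambda_{mn}\in\mathbb R$. Let $\rho_1,\dots,\rho_r$ be the distinct non-zero eigenvalues of $C$, with $J_t=\{s:\lambda_s=\rho_t\}$ and $P_t=\sum_{j\in J_t}v_jv_j^*$. Put (inner product linear in the second variable) $$w_s=\sum_{i=1}^n\sum_{j=1}^m\langle E_i\otimes E_j,v_s\rangle\,e_{m+i,j}\in\mathcal A,\qquad Q_t=\sum_{j\in J_t}w_jw_j^*\in\mathcal A,\qquad f=\sum_{s:\lambda_s\ne0}w_s^*\otimes v_s .$$ Thus $ff^*=\sum_{h,h'}w_h^*w_{h'}\otimes v_hv_{h'}^*\in\mathcal A\otimes M_{nm}(\mathbb C)$, the sum being over $h,h'$ with $\lambda_h,\lambda_{h'}\neq 0$. Tracially well behaved eigenspaces: for all $k$, all $i_1,\dots,i_k\le r$, and all $j_1,j_1',j_2\le mn$ such that $j_1,j_1'\in J_i$ for some $i\le r$, $$\tau(w_{j_1}w_{j_2}^*Q_{i_1}\cdots Q_{i_k})=\delta_{j_1j_2}\tau(w_{j_1}w_{j_1}^*Q_{i_1}\cdots Q_{i_k})=\delta_{j_1j_2}\tau(w_{j_1'}w_{j_1'}^*Q_{i_1}\cdots Q_{i_k}).$$ Amalgamated freeness over $\mathcal B$ is with respect to the conditional expectation $\mathcal A\otimes M_{nm}(\mathbb C)\to\mathcal B$ obtained by composing $\psi\otimes\mathrm{id}$ with $\mathrm{id}\otimes(\text{the trace-preserving conditional expectation } M_{nm}(\mathbb C)\to\langle C\rangle)$, where $\langle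 C\rangle$ is the unital algebra generated by $C$. Two self-adjoint elements $a_1,a_2$ are free over $\mathcal B$ if alternating products of elements of the algebras $\langle a_1,\mathcal B\rangle$ and $\langle a_2,\mathcal B\rangle$, each with vanishing conditional expectation, have vanishing conditional expectation. *)

theory Defs
  imports "HOL-Analysis.Analysis"
begin

section \<open>Unital C*-algebras and tracial states\<close>

class cstar_algebra = real_normed_algebra_1 + banach +
  fixes scaleC :: "complex \<Rightarrow> 'a \<Rightarrow> 'a"  (infixr "*\<^sub>C" 75)
    and star :: "'a \<Rightarrow> 'a"
  assumes scaleC_add_right: "c *\<^sub>C (x + y) = c *\<^sub>C x + c *\<^sub>C y"
    and scaleC_add_left: "(c + d) *\<^sub>C x = c *\<^sub>C x + d *\<^sub>C x"
    and scaleC_scaleC: "c *\<^sub>C (d *\<^sub>C x) = (c * d) *\<^sub>C x"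
    and scaleC_of_real: "complex_of_real r *\<^sub>C x = r *\<^sub>R x"
    and scaleC_mult_left: "(c *\<^sub>C x) * y = c *\<^sub>C (x * y)"
    and scaleC_mult_right: "x * (c *\<^sub>C y) = c *\<^sub>C (x * y)"
    and norm_scaleC: "norm (c *\<^sub>C x) = cmod c * norm x"
    and star_star: "star (star x) = x"
    and star_add: "star (x + y) = star x + star y"
    and star_scaleC: "star (c *\<^sub>C x) = cnj c *\<^sub>C star x"
    and star_mult: "star (x * y) = star y * star x"
    and norm_star_mult: "norm (star x * x) = (norm x)\<^sup>2"

instantiation complex :: cstar_algebra
begin

definition scaleC_complex :: "complex \<Rightarrow> complex \<Rightarrow> complex" where
  "scaleC_complex c x = c * x"

definition star_complex :: "complex \<Rightarrow> complex" where
  "star_complex = cnj"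

instance
  by standard
    (auto simp: scaleC_complex_def star_complex_def algebra_simps scaleR_conv_of_real
      norm_mult power2_eq_square)

end

definition tracial_state :: "('a::cstar_algebra \<Rightarrow> complex) \<Rightarrow> bool" where
  "tracial_state \<tau> \<longleftrightarrow>
     Vector_Spaces.linear scaleC (*) \<tau> \<and> \<tau> 1 = 1 \<and>
     (\<forall>a. \<tau> (star a * a) \<in> \<real>\<^sub>\<ge>\<^sub>0) \<and>
     (\<forall>a b. \<tau> (a * b) = \<tau> (b * a))"


section \<open>Matrices over a C*-algebra\<close>

text \<open>
  \<open>\<A> \<otimes> M\<^sub>k(\<complex>)\<close> is identified with the matrices over \<open>\<A>\<close>, so that \<open>M\<^sub>k(\<complex>)\<close>
  is the special case \<open>\<A> = \<complex>\<close>.  The multiplication is \<^term>\<open>(**)\<close>.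
\<close>

definition mscale :: "complex \<Rightarrow> 'a::cstar_algebra^'k^'l \<Rightarrow> 'a^'k^'l" where
  "mscale c X = (\<chi> p q. c *\<^sub>C X$p$q)"

definition adj :: "'a::cstar_algebra^'k^'l \<Rightarrow> 'a^'l^'k" where
  "adj X = (\<chi> p q. star (X$q$p))"

definition tensor :: "'a::cstar_algebra \<Rightarrow> complex^'k^'l \<Rightarrow> 'a^'k^'l"  (infixr "\<otimes>\<^sub>m" 70) where
  "x \<otimes>\<^sub>m M = (\<chi> p q. M$p$q *\<^sub>C x)"

definition tensor_vec :: "'a::cstar_algebra \<Rightarrow> complex^'k \<Rightarrow> 'a^'k"  (infixr "\<otimes>\<^sub>v" 70) where
  "x \<otimes>\<^sub>v u = (\<chi> p. u$p *\<^sub>C x)"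

text \<open>The matrix \<open>g g\<^sup>*\<close> of a column vector \<open>g\<close> over \<open>\<A>\<close>.\<close>

definition outer :: "'a::cstar_algebra^'k \<Rightarrow> 'a^'k^'k" where
  "outer g = (\<chi> p q. g$p * star (g$q))"

definition matrix_unit :: "'k \<Rightarrow> 'k \<Rightarrow> complex^'k^'k" where
  "matrix_unit i j = (\<chi> p q. if p = i \<and> q = j then 1 else 0)"

definition kron :: "complex^'n^'n \<Rightarrow> complex^'m^'m \<Rightarrow> complex^('n \<times> 'm)^('n \<times> 'm)" where
  "kron A B = (\<chi> p q. A$(fst p)$(fst q) * B$(snd p)$(snd q))"

definition kron_vec :: "complex^'n \<Rightarrow> complex^'m \<Rightarrow> complex^('n \<times> 'm)" where
  "kron_vec u v = (\<chi> p. u$(fst p) * v$(snd p))"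

definition cinner :: "complex^'k \<Rightarrow> complex^'k \<Rightarrow> complex" where
  "cinner u v = (\<Sum>p\<in>UNIV. cnj (u$p) * v$p)"


section \<open>Generated algebras, conditional expectations and amalgamated freeness\<close>

text \<open>
  The unit, multiplication and complex scaling are parameters, because square
  matrices over \<open>\<A>\<close> do not form an instance of a ring class with \<^term>\<open>(**)\<close>.
\<close>

inductive_set gen_alg :: "'b::plus \<Rightarrow> ('b \<Rightarrow> 'b \<Rightarrow> 'b) \<Rightarrow> (complex \<Rightarrow> 'b \<Rightarrow> 'b) \<Rightarrow> 'b set \<Rightarrow> 'b set"
  for one mul scl S where
    gen: "x \<in> S \<Longrightarrow> x \<in> gen_alg one mul scl S"
  | one: "one \<in> gen_alg one mul scl S"
  | add: "x \<in> gen_alg one mul scl S \<Longrightarrow> y \<in> gen_alg one mul scl S \<Longrightarrow> x + y \<in> gen_alg one mul scl S"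
  | scl: "x \<in> gen_alg one mul scl S \<Longrightarrow> scl c x \<in> gen_alg one mul scl S"
  | mul: "x \<in> gen_alg one mul scl S \<Longrightarrow> y \<in> gen_alg one mul scl S \<Longrightarrow> mul x y \<in> gen_alg one mul scl S"

abbreviation alg :: "'a::cstar_algebra set \<Rightarrow> 'a set" where
  "alg \<equiv> gen_alg 1 (*) (*\<^sub>C)"

abbreviation mat_alg :: "('a::cstar_algebra^'k^'k) set \<Rightarrow> ('a^'k^'k) set" where
  "mat_alg \<equiv> gen_alg (mat 1) (**) mscale"

text \<open>
  Two subalgebras are free with amalgamation with respect to an expectation \<open>E\<close> if every
  alternating product of elements of \<open>ker E\<close> is in \<open>ker E\<close>.  A factor is tagged with
  \<^term>\<open>True\<close> or \<^term>\<open>False\<close> according to whether it is taken from \<open>A1\<close> or \<open>A2\<close>.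
\<close>

definition free_amalg ::
    "'b::zero \<Rightarrow> ('b \<Rightarrow> 'b \<Rightarrow> 'b) \<Rightarrow> ('b \<Rightarrow> 'b) \<Rightarrow> 'b set \<Rightarrow> 'b set \<Rightarrow> bool" where
  "free_amalg one mul E A1 A2 \<longleftrightarrow>
     (\<forall>xs :: (bool \<times> 'b) list.
        xs \<noteq> [] \<and> distinct_adj (map fst xs) \<and>
        (\<forall>(b, x) \<in> set xs. x \<in> (if b then A1 else A2) \<and> E x = 0) \<longrightarrow>
        E (foldr mul (map snd xs) one) = 0)"

definition free_over :: "('a::cstar_algebra \<Rightarrow> 'a) \<Rightarrow> 'a set \<Rightarrow> 'a set \<Rightarrow> 'a set \<Rightarrow> bool" where
  "free_over E D S1 S2 \<longleftrightarrow> free_amalg 1 (*) E (alg (S1 \<union> D)) (alg (S2 \<union> D))"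

definition mat_free_over ::
    "('a::cstar_algebra^'k^'k \<Rightarrow> 'a^'k^'k) \<Rightarrow> ('a^'k^'k) set \<Rightarrow> ('a^'k^'k) set \<Rightarrow> ('a^'k^'k) set \<Rightarrow> bool"
  where
  "mat_free_over E D S1 S2 \<longleftrightarrow> free_amalg (mat 1) (**) E (mat_alg (S1 \<union> D)) (mat_alg (S2 \<union> D))"

definition is_trace_cond_exp ::
    "(complex^'k^'k) set \<Rightarrow> (complex^'k^'k \<Rightarrow> complex^'k^'k) \<Rightarrow> bool" where
  "is_trace_cond_exp D F \<longleftrightarrow>
     (\<forall>X Y. F (X + Y) = F X + F Y) \<and> (\<forall>c X. F (mscale c X) = mscale c (F X)) \<and>
     (\<forall>X. F X \<in> D) \<and> (\<forall>Y\<in>D. F Y = Y) \<and>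
     (\<forall>X. \<forall>Y\<in>D. \<forall>Z\<in>D. F (Y ** X ** Z) = Y ** F X ** Z) \<and>
     (\<forall>X. trace (F X) = trace X)"

definition trace_cond_exp :: "(complex^'k^'k) set \<Rightarrow> complex^'k^'k \<Rightarrow> complex^'k^'k" where
  "trace_cond_exp D = (THE F. is_trace_cond_exp D F)"

text \<open>
  For self-adjoint \<open>C\<close> there is exactly one trace-preserving conditional expectation onto \<open>\<langle>C\<rangle>\<close>;
  positivity follows from the listed properties.
\<close>

lemma vector_space_scaleC: "vector_space (scaleC :: complex \<Rightarrow> 'a::cstar_algebra \<Rightarrow> 'a)"
  using scaleC_of_real[of 1]
  by unfold_locales (auto simp: scaleC_add_right scaleC_add_left scaleC_scaleC)

lemma vector_space_mscale:
  "vector_space (mscale :: complex \<Rightarrow> 'a::cstar_algebra^'k^'l \<Rightarrow> 'a^'k^'l)"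
  using scaleC_of_real[of 1]
  by unfold_locales
     (auto simp: mscale_def vec_eq_iff scaleC_add_right scaleC_add_left scaleC_scaleC)

lemma mscale_complex [simp]: "mscale c (X :: complex^'k^'l) $ p $ q = c * X $ p $ q"
  by (simp add: mscale_def scaleC_complex_def)

lemma adj_complex [simp]: "adj (X :: complex^'k^'l) $ p $ q = cnj (X $ q $ p)"
  by (simp add: adj_def star_complex_def)

lemma inner_eq_trace: "Y \<bullet> X = Re (trace (adj Y ** X))" for X Y :: "complex^'k^'k"
proof -
  have "Y \<bullet> X = (\<Sum>i\<in>UNIV. \<Sum>j\<in>UNIV. Re (cnj (Y$i$j) * X$i$j))"
    by (simp add: inner_vec_def inner_complex_def)
  also have "\<dots> = (\<Sum>j\<in>UNIV. \<Sum>i\<in>UNIV. Re (cnj (Y$i$j) * X$i$j))"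
    by (rule sum.swap)
  also have "\<dots> = Re (trace (adj Y ** X))"
    by (simp add: trace_def matrix_matrix_mult_def)
  finally show ?thesis .
qed

lemma mscale_mult: "mscale c X ** Y = mscale c (X ** Y)" "X ** mscale c Y = mscale c (X ** Y)"
  for X Y :: "complex^'k^'k"
  by (simp_all add: vec_eq_iff matrix_matrix_mult_def sum_distrib_left algebra_simps)

lemma trace_mscale: "trace (mscale c X) = c * trace X" for X :: "complex^'k^'k"
  by (simp add: trace_def sum_distrib_left)

lemma adj_mult: "adj (X ** Y) = adj Y ** adj X" for X Y :: "complex^'k^'k"
  by (simp add: vec_eq_iff matrix_matrix_mult_def mult.commute)

lemma mat_alg_adj:
  fixes C :: "complex^'k^'k"
  assumes C: "adj C = C" and "X \<in> mat_alg {C}"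
  shows "adj X \<in> mat_alg {C}"
  using assms(2)
proof induction
  case (gen X)
  then show ?case using C by (simp add: gen_alg.gen)
next
  case one
  have "adj (mat 1 :: complex^'k^'k) = mat 1"
    by (simp add: vec_eq_iff mat_def)
  then show ?case by (simp add: gen_alg.one)
next
  case (add X Y)
  have "adj (X + Y) = adj X + adj Y" by (simp add: vec_eq_iff)
  then show ?case using add by (simp add: gen_alg.add)
next
  case (scl X c)
  have "adj (mscale c X) = mscale (cnj c) (adj X)" by (simp add: vec_eq_iff)
  then show ?case using scl by (simp add: gen_alg.scl)
next
  case (mul X Y)
  then show ?case by (simp add: adj_mult gen_alg.mul)
qed

lemma trace_cond_exp_unique_existence:
  fixes C :: "complex^'k^'k"
  assumes C: "adj C = C"
  shows "\<exists>!F. is_trace_cond_exp (mat_alg {C}) F"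
proof -
  let ?D = "mat_alg {C}"
  have D1: "mat 1 \<in> ?D" by (rule gen_alg.one)
  have Dadd: "X + Y \<in> ?D" if "X \<in> ?D" "Y \<in> ?D" for X Y
    using that by (rule gen_alg.add)
  have Dscl: "mscale c X \<in> ?D" if "X \<in> ?D" for c X
    using that by (rule gen_alg.scl)
  have Dmul: "X ** Y \<in> ?D" if "X \<in> ?D" "Y \<in> ?D" for X Y
    using that by (rule gen_alg.mul)
  have Dadj: "adj X \<in> ?D" if "X \<in> ?D" for X
    using C that by (rule mat_alg_adj)
  have Ddiff: "X - Y \<in> ?D" if "X \<in> ?D" "Y \<in> ?D" for X Y
  proof -
    have "X - Y = X + mscale (-1) Y" by (simp add: vec_eq_iff)
    then show ?thesis using that Dadd Dscl by metis
  qed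
  have span: "span ?D = ?D"
  proof -
    have "subspace ?D"
      unfolding subspace_def
    proof (intro conjI ballI allI)
      have "(0::complex^'k^'k) = mscale 0 (mat 1)" by (simp add: vec_eq_iff)
      then show "0 \<in> ?D" using Dscl D1 by metis
    next
      fix c :: real and X assume "X \<in> ?D"
      have "c *\<^sub>R X = mscale (of_real c) X"
        by (simp add: vec_eq_iff scaleR_conv_of_real[symmetric])
      then show "c *\<^sub>R X \<in> ?D" using Dscl \<open>X \<in> ?D\<close> by simp
    qed (use Dadd in auto)
    then show ?thesis by (simp add: span_eq_iff)
  qed
  have uniq: "N = N'" if N: "N \<in> ?D" "N' \<in> ?D" "\<And>Y. Y \<in> ?D \<Longrightarrow> trace (Y ** N) = trace (Y ** N')" for N N'
  proof -
    have "adj (N - N') \<in> ?D" using Dadj Ddiff N by blast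
    then have "trace (adj (N - N') ** N) = trace (adj (N - N') ** N')"
      by (rule N(3))
    moreover have "trace (adj (N - N') ** N) =
        trace (adj (N - N') ** (N - N')) + trace (adj (N - N') ** N')"
      by (simp flip: matrix_add_ldistrib trace_add)
    ultimately have "trace (adj (N - N') ** (N - N')) = 0"
      by simp
    then have "(N - N') \<bullet> (N - N') = 0" by (simp add: inner_eq_trace)
    then show ?thesis by simp
  qed
  have "\<exists>N. N \<in> ?D \<and> (\<forall>Y\<in>?D. trace (Y ** N) = trace (Y ** X))" for X
  proof -
    obtain N Z where N: "N \<in> ?D" and Z: "\<And>W. W \<in> ?D \<Longrightarrow> orthogonal Z W" and X: "X = N + Z"
      using orthogonal_subspace_decomp_exists[of ?D X] unfolding span by metis
    have "trace (Y ** Z) = 0" if Y: "Y \<in> ?D" for Y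
    proof -
      have re: "Re (trace (Y' ** Z)) = 0" if "Y' \<in> ?D" for Y'
      proof -
        have "adj (adj Y') = Y'" by (simp add: vec_eq_iff)
        then show ?thesis
          using Z[OF Dadj[OF that]] inner_eq_trace[of "adj Y'" Z]
          by (simp add: orthogonal_def inner_commute)
      qed
      have "Im (trace (Y ** Z)) = 0"
        using re[OF Dscl[OF Y, of \<i>]] by (simp add: mscale_mult trace_mscale)
      then show ?thesis using re[OF Y] by (simp add: complex_eq_iff)
    qed
    then have "\<forall>Y\<in>?D. trace (Y ** N) = trace (Y ** X)"
      by (simp add: X matrix_add_ldistrib trace_add)
    then show ?thesis using N by blast
  qed
  then obtain F where FD: "\<And>X. F X \<in> ?D" and F: "\<And>X Y. Y \<in> ?D \<Longrightarrow> trace (Y ** F X) = trace (Y ** X)"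
    by metis
  have "is_trace_cond_exp ?D F"
    unfolding is_trace_cond_exp_def
  proof (intro conjI allI ballI)
    show "F (X + Y) = F X + F Y" for X Y
      by (rule uniq) (simp_all add: FD Dadd F matrix_add_ldistrib trace_add)
    show "F (mscale c X) = mscale c (F X)" for c X
      by (rule uniq) (simp_all add: FD Dscl F mscale_mult trace_mscale)
    show "F X \<in> ?D" for X by (rule FD)
    show "F Y = Y" if "Y \<in> ?D" for Y
      by (rule uniq) (simp_all add: FD that F)
    show "F (Y ** X ** Z) = Y ** F X ** Z" if "Y \<in> ?D" "Z \<in> ?D" for X Y Z
    proof (rule uniq)
      fix W assume W: "W \<in> ?D"
      have *: "trace (W ** (Y ** V ** Z)) = trace ((Z ** W ** Y) ** V)" for V
        using trace_mul_sym[of "W ** Y ** V" Z] by (simp add: matrix_mul_assoc)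
      show "trace (W ** F (Y ** X ** Z)) = trace (W ** (Y ** F X ** Z))"
        using F[OF W] F[OF Dmul[OF Dmul[OF that(2) W] that(1)]] by (simp add: *)
    qed (use that FD Dmul in auto)
    show "trace (F X) = trace X" for X
      using F[OF D1, of X] by simp
  qed
  moreover have "G = F" if G: "is_trace_cond_exp ?D G" for G
  proof
    fix X
    have "trace (Y ** G X) = trace (Y ** X)" if Y: "Y \<in> ?D" for Y
    proof -
      have "G (Y ** X ** mat 1) = Y ** G X ** mat 1" "trace (G (Y ** X)) = trace (Y ** X)"
        using G Y D1 unfolding is_trace_cond_exp_def by blast+
      then show ?thesis by simp
    qed
    moreover have "G X \<in> ?D" using G unfolding is_trace_cond_exp_def by blast
    ultimately show "G X = F X"
      by (intro uniq) (simp_all add: FD F)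
  qed
  ultimately show ?thesis by blast
qed


section \<open>The Choi matrix and the elements attached to its eigenvectors\<close>

definition hermiticity_preserving :: "(complex^'m^'m \<Rightarrow> complex^'n^'n) \<Rightarrow> bool" where
  "hermiticity_preserving \<phi> \<longleftrightarrow> (\<forall>A. adj A = A \<longrightarrow> adj (\<phi> A) = \<phi> A)"

definition choi :: "(complex^'m^'m \<Rightarrow> complex^'n^'n) \<Rightarrow> complex^('n \<times> 'm)^('n \<times> 'm)" where
  "choi \<phi> = (\<Sum>i\<in>UNIV. \<Sum>j\<in>UNIV. kron (\<phi> (matrix_unit i j)) (matrix_unit i j))"

definition orthonormal_eigenbasis ::
    "complex^'k^'k \<Rightarrow> (nat \<Rightarrow> complex^'k) \<Rightarrow> (nat \<Rightarrow> real) \<Rightarrow> bool" where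
  "orthonormal_eigenbasis C v lam \<longleftrightarrow>
     (\<forall>s\<in>{1..CARD('k)}. \<forall>t\<in>{1..CARD('k)}. cinner (v s) (v t) = (if s = t then 1 else 0)) \<and>
     (\<forall>s\<in>{1..CARD('k)}. C *v v s = complex_of_real (lam s) *s v s)"

text \<open>
  A system of \<open>m + n\<close> matrix units is indexed by the sum type \<^typ>\<open>'m + 'n\<close>: the index \<open>i \<le> m\<close> is
  \<^term>\<open>Inl i\<close> and the index \<open>m + i\<close> is \<^term>\<open>Inr i\<close>.
\<close>

definition unital_matrix_units :: "('k::finite \<Rightarrow> 'k \<Rightarrow> 'a::cstar_algebra) \<Rightarrow> bool" where
  "unital_matrix_units e \<longleftrightarrow>
     (\<forall>i j k l. e i j * e k l = (if j = k then e i l else 0)) \<and>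
     (\<forall>i j. star (e i j) = e j i) \<and> (\<Sum>i\<in>UNIV. e i i) = 1"

definition pm :: "('m::finite + 'n::finite \<Rightarrow> 'm + 'n \<Rightarrow> 'a::cstar_algebra) \<Rightarrow> 'a" where
  "pm e = (\<Sum>i\<in>UNIV. e (Inl i) (Inl i))"

definition pn :: "('m::finite + 'n::finite \<Rightarrow> 'm + 'n \<Rightarrow> 'a::cstar_algebra) \<Rightarrow> 'a" where
  "pn e = (\<Sum>i\<in>UNIV. e (Inr i) (Inr i))"

definition psi ::
    "('a::cstar_algebra \<Rightarrow> complex) \<Rightarrow> ('m::finite + 'n::finite \<Rightarrow> 'm + 'n \<Rightarrow> 'a) \<Rightarrow> 'a \<Rightarrow> 'a" where
  "psi \<tau> e a = (inverse (\<tau> (pm e)) * \<tau> (pm e * a)) *\<^sub>C pm e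
             + (inverse (\<tau> (pn e)) * \<tau> (pn e * a)) *\<^sub>C pn e"

definition w_elem ::
    "('m::finite + 'n::finite \<Rightarrow> 'm + 'n \<Rightarrow> 'a::cstar_algebra) \<Rightarrow> (nat \<Rightarrow> complex^('n \<times> 'm)) \<Rightarrow> nat \<Rightarrow> 'a"
  where
  "w_elem e v s =
     (\<Sum>i\<in>UNIV. \<Sum>j\<in>UNIV. cinner (kron_vec (axis i 1) (axis j 1)) (v s) *\<^sub>C e (Inr i) (Inl j))"

text \<open>
  The \<open>Q\<^sub>t\<close> are indexed by the eigenvalues \<open>\<rho>\<^sub>t\<close> themselves instead of their numbers \<open>t\<close>.
\<close>

definition Q_elem ::
    "('m::finite + 'n::finite \<Rightarrow> 'm + 'n \<Rightarrow> 'a::cstar_algebra) \<Rightarrow> (nat \<Rightarrow> complex^('n \<times> 'm)) \<Rightarrow>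
     (nat \<Rightarrow> real) \<Rightarrow> real \<Rightarrow> 'a" where
  "Q_elem e v lam \<rho> =
     (\<Sum>j\<in>{j \<in> {1..CARD('n \<times> 'm)}. lam j = \<rho>}. w_elem e v j * star (w_elem e v j))"

definition tracially_well_behaved ::
    "('a::cstar_algebra \<Rightarrow> complex) \<Rightarrow> ('m::finite + 'n::finite \<Rightarrow> 'm + 'n \<Rightarrow> 'a) \<Rightarrow>
     (nat \<Rightarrow> complex^('n \<times> 'm)) \<Rightarrow> (nat \<Rightarrow> real) \<Rightarrow> bool" where
  "tracially_well_behaved \<tau> e v lam \<longleftrightarrow>
     (let S = {1..CARD('n \<times> 'm)};
          w = w_elem e v;
          M = (\<lambda>j k \<rho>s. \<tau> (w j * star (w k) * prod_list (map (Q_elem e v lam) \<rho>s)));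
          \<delta> = (\<lambda>j k. if j = k then 1 else 0)
      in \<forall>\<rho>s. set \<rho>s \<subseteq> lam ` S - {0} \<longrightarrow>
           (\<forall>j1\<in>S. \<forall>j1'\<in>S. \<forall>j2\<in>S. lam j1 = lam j1' \<and> lam j1 \<noteq> 0 \<longrightarrow>
              M j1 j2 \<rho>s = \<delta> j1 j2 * M j1 j1 \<rho>s \<and>
              \<delta> j1 j2 * M j1 j1 \<rho>s = \<delta> j1 j2 * M j1' j1' \<rho>s))"

definition f_vec ::
    "('m::finite + 'n::finite \<Rightarrow> 'm + 'n \<Rightarrow> 'a::cstar_algebra) \<Rightarrow> (nat \<Rightarrow> complex^('n \<times> 'm)) \<Rightarrow>
     (nat \<Rightarrow> real) \<Rightarrow> 'a^('n \<times> 'm)" where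
  "f_vec e v lam = (\<Sum>s\<in>{s \<in> {1..CARD('n \<times> 'm)}. lam s \<noteq> 0}. star (w_elem e v s) \<otimes>\<^sub>v v s)"


section \<open>The algebra of amalgamation and its conditional expectation\<close>

definition amalg_alg ::
    "('m::finite + 'n::finite \<Rightarrow> 'm + 'n \<Rightarrow> 'a::cstar_algebra) \<Rightarrow> complex^'k^'k \<Rightarrow> ('a^'k^'k) set"
  where
  "amalg_alg e C = mat_alg {pm e \<otimes>\<^sub>m mat 1, pn e \<otimes>\<^sub>m mat 1, 1 \<otimes>\<^sub>m C}"

definition tensor_id :: "('a::cstar_algebra \<Rightarrow> 'a) \<Rightarrow> 'a^'k^'k \<Rightarrow> 'a^'k^'k" where
  "tensor_id g X = (\<chi> p q. g (X$p$q))"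

definition id_tensor :: "(complex^'k^'k \<Rightarrow> complex^'k^'k) \<Rightarrow> 'a::cstar_algebra^'k^'k \<Rightarrow> 'a^'k^'k" where
  "id_tensor F X = (\<Sum>p\<in>UNIV. \<Sum>q\<in>UNIV. X$p$q \<otimes>\<^sub>m F (matrix_unit p q))"

definition amalg_exp ::
    "('a::cstar_algebra \<Rightarrow> complex) \<Rightarrow> ('m::finite + 'n::finite \<Rightarrow> 'm + 'n \<Rightarrow> 'a) \<Rightarrow> complex^'k^'k \<Rightarrow>
     'a^'k^'k \<Rightarrow> 'a^'k^'k" where
  "amalg_exp \<tau> e C = id_tensor (trace_cond_exp (mat_alg {C})) \<circ> tensor_id (psi \<tau> e)"

end

theory Submission
  imports Defs
begin

text \<open>
  Written in the eigenbasis of \<open>C\<close>, an element of \<open>\<langle>x \<otimes> C, \<B>\<rangle>\<close> is diagonal with entries in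
  \<open>\<langle>x, p\<^sub>m, p\<^sub>n\<rangle>\<close> depending only on the eigenvalue, and an element of \<open>\<langle>f f\<^sup>*, \<B>\<rangle>\<close> is such a
  diagonal matrix over \<open>\<langle>p\<^sub>m, p\<^sub>n\<rangle>\<close> plus a matrix with entries \<open>w\<^sub>h\<^sup>* g w\<^sub>h\<^sub>'\<close>, where \<open>g\<close> is a
  polynomial in the \<open>Q\<^sub>t\<close> depending only on the two eigenvalues.  Tracial well-behavedness implies
  that \<open>\<psi> \<otimes> id\<close> already maps both algebras into \<open>\<B>\<close>.  Hence an element in the kernel of the
  expectation onto \<open>\<B>\<close> has all its entries in the kernel of \<open>\<psi>\<close>, and the entries of an
  alternating product of such matrices are sums of alternating products in \<open>\<A>\<close>, to which the
  assumed freeness applies.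
\<close>

section \<open>Scalar multiples, the star operation and finite sums\<close>

lemma module_scaleC: "module (scaleC :: complex \<Rightarrow> 'a::cstar_algebra \<Rightarrow> 'a)"
  using vector_space_scaleC by (simp add: module_iff_vector_space)

lemma scaleC_one [simp]: "1 *\<^sub>C (a::'a::cstar_algebra) = a"
  using scaleC_of_real[of 1 a] by simp

lemma scaleC_zero_left [simp]: "0 *\<^sub>C (a::'a::cstar_algebra) = 0"
  using module.scale_zero_left[OF module_scaleC] .

lemma scaleC_zero_right [simp]: "c *\<^sub>C (0::'a::cstar_algebra) = 0"
  using module.scale_zero_right[OF module_scaleC] .

lemma scaleC_sum_left: "(\<Sum>i\<in>A. c i) *\<^sub>C (a::'a::cstar_algebra) = (\<Sum>i\<in>A. c i *\<^sub>C a)"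
  using module.scale_sum_left[OF module_scaleC] .

lemma scaleC_sum_right: "c *\<^sub>C (\<Sum>i\<in>A. a i :: 'a::cstar_algebra) = (\<Sum>i\<in>A. c *\<^sub>C a i)"
  using module.scale_sum_right[OF module_scaleC] .

lemma scaleC_complex [simp]: "c *\<^sub>C (z::complex) = c * z"
  by (simp add: scaleC_complex_def)

lemma star_sum: "star (\<Sum>i\<in>A. a i :: 'a::cstar_algebra) = (\<Sum>i\<in>A. star (a i))"
proof -
  have "star (0::'a) = 0"
    using star_scaleC[of 0 "0::'a"] by simp
  then show ?thesis
    by (induction A rule: infinite_finite_induct) (auto simp: star_add)
qed

section \<open>Closure principles for generated algebras\<close>

text \<open>Associativity peels one generator at a time off the left factor. Normal forms can thus
  be proved by multiplying with generators only; two general normal forms never have to be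
  multiplied. The operations are parameters so that \<open>'a\<close> and the matrices over it are
  both covered.\<close>

lemma gen_alg_mul_closed:
  assumes X: "X \<in> gen_alg one mul scl S" and Y: "Y \<in> L"
    and gen: "\<And>X Y. X \<in> S \<Longrightarrow> Y \<in> L \<Longrightarrow> mul X Y \<in> L"
    and add: "\<And>Y Z. Y \<in> L \<Longrightarrow> Z \<in> L \<Longrightarrow> Y + Z \<in> L"
    and scl: "\<And>c Y. Y \<in> L \<Longrightarrow> scl c Y \<in> L"
    and mul_one: "\<And>Y. mul one Y = Y"
    and mul_add: "\<And>X X' Y. mul (X + X') Y = mul X Y + mul X' Y"
    and mul_scl: "\<And>c X Y. mul (scl c X) Y = scl c (mul X Y)"
    and assoc: "\<And>X X' Y. mul (mul X X') Y = mul X (mul X' Y)"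
  shows "mul X Y \<in> L"
  using X Y
  by (induction arbitrary: Y) (simp_all add: gen add scl mul_one mul_add mul_scl assoc)

lemma alg_mul_closed:
  assumes "a \<in> alg S" "b \<in> L"
    and "\<And>a b. a \<in> S \<Longrightarrow> b \<in> L \<Longrightarrow> a * b \<in> L"
    and "\<And>a b. a \<in> L \<Longrightarrow> b \<in> L \<Longrightarrow> a + b \<in> L"
    and "\<And>c a. a \<in> L \<Longrightarrow> c *\<^sub>C a \<in> L"
  shows "a * b \<in> L"
  using assms(1,2)
  by (rule gen_alg_mul_closed)
    (simp_all add: assms scaleC_mult_left algebra_simps)

lemma mscale_matrix_mult:
  fixes X Y :: "'a::cstar_algebra^'k^'k"
  shows "mscale c X ** Y = mscale c (X ** Y)"
  by (simp add: vec_eq_iff matrix_matrix_mult_def mscale_def scaleC_mult_left scaleC_sum_right)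

lemma matrix_matrix_mult_add:
  fixes X Y Z :: "'a::semiring_1^'k^'k"
  shows "(X + Y) ** Z = X ** Z + Y ** Z"
  by (simp add: matrix_matrix_mult_def vec_eq_iff distrib_right sum.distrib)

lemma mat_alg_mul_closed:
  fixes X Y :: "'a::cstar_algebra^'k^'k"
  assumes "X \<in> mat_alg S" "Y \<in> L"
    and "\<And>X Y. X \<in> S \<Longrightarrow> Y \<in> L \<Longrightarrow> X ** Y \<in> L"
    and "\<And>Y Z. Y \<in> L \<Longrightarrow> Z \<in> L \<Longrightarrow> Y + Z \<in> L"
    and "\<And>c Y. Y \<in> L \<Longrightarrow> mscale c Y \<in> L"
  shows "X ** Y \<in> L"
  using assms(1,2)
  by (rule gen_alg_mul_closed)
    (simp_all add: assms mscale_matrix_mult matrix_mul_assoc matrix_matrix_mult_add)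

text \<open>To be used with \<open>L\<close> a set of matrices in normal form. The algebra
  \<open>amalg_alg e C\<close> is itself generated, so the closure principle is applied twice: once
  inside it and once for the union, starting from \<open>mat 1\<close>.\<close>

lemma mat_alg_amalg_subset:
  assumes gen: "\<And>X Y. X \<in> S \<Longrightarrow> Y \<in> L \<Longrightarrow> X ** Y \<in> L"
    and pm: "\<And>Y. Y \<in> L \<Longrightarrow> (pm e \<otimes>\<^sub>m mat 1) ** Y \<in> L"
    and pn: "\<And>Y. Y \<in> L \<Longrightarrow> (pn e \<otimes>\<^sub>m mat 1) ** Y \<in> L"
    and C: "\<And>Y. Y \<in> L \<Longrightarrow> (1 \<otimes>\<^sub>m C) ** Y \<in> L"
    and one: "mat 1 \<in> L"
    and add: "\<And>Y Z. Y \<in> L \<Longrightarrow> Z \<in> L \<Longrightarrow> Y + Z \<in> L"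
    and scl: "\<And>c Y. Y \<in> L \<Longrightarrow> mscale c Y \<in> L"
  shows "mat_alg (S \<union> amalg_alg e C) \<subseteq> L"
proof
  fix X assume X: "X \<in> mat_alg (S \<union> amalg_alg e C)"
  have B: "X ** Y \<in> L" if "X \<in> amalg_alg e C" "Y \<in> L" for X Y
    using that(1)[unfolded amalg_alg_def] that(2)
    by (rule mat_alg_mul_closed) (auto intro: pm pn C add scl)
  have "X ** mat 1 \<in> L"
    using X one by (rule mat_alg_mul_closed) (auto intro: gen B add scl)
  then show "X \<in> L" by simp
qed

lemma alg_sum:
  assumes "\<And>i. i \<in> A \<Longrightarrow> a i \<in> alg S"
  shows "(\<Sum>i\<in>A. a i) \<in> alg S"
proof -
  have "0 *\<^sub>C 1 \<in> alg S" by (intro gen_alg.intros)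
  then have "0 \<in> alg S" by simp
  then show ?thesis
    using assms by (induction A rule: infinite_finite_induct) (auto intro: gen_alg.add)
qed

lemma alg_mono:
  assumes "a \<in> alg S" "S \<subseteq> alg T"
  shows "a \<in> alg T"
  using assms(1) by induction (use assms(2) in \<open>auto intro: gen_alg.intros\<close>)

section \<open>The map \<open>id_tensor\<close> on elementary tensors\<close>

text \<open>\<open>id_tensor\<close> is defined through the values of \<open>F\<close> on matrix
  units; expanding \<open>M\<close> in matrix units and using linearity of \<open>F\<close> gives
  its value on every elementary tensor.\<close>

lemma id_tensor_tensor:
  fixes F :: "complex^'k^'k \<Rightarrow> complex^'k^'k"
  assumes add: "\<And>X Y. F (X + Y) = F X + F Y" and scl: "\<And>c X. F (mscale c X) = mscale c (F X)"
  shows "id_tensor F (a \<otimes>\<^sub>m M) = a \<otimes>\<^sub>m F M"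
proof -
  have "F 0 = 0" using add[of 0 0] by simp
  then have F_sum: "F (\<Sum>i\<in>A. X i) = (\<Sum>i\<in>A. F (X i))" for A :: "'k set" and X
    by (induction A rule: infinite_finite_induct) (auto simp: add)
  have "M = (\<Sum>p\<in>UNIV. \<Sum>q\<in>UNIV. mscale (M$p$q) (matrix_unit p q))"
  proof -
    have "(\<Sum>p\<in>UNIV. \<Sum>q\<in>UNIV. M$p$q * (if i = p \<and> j = q then 1 else 0)) = M$i$j" for i j
    proof -
      have "(\<Sum>p\<in>UNIV. \<Sum>q\<in>UNIV. M$p$q * (if i = p \<and> j = q then 1 else 0)) =
          (\<Sum>p\<in>UNIV. if i = p then (\<Sum>q\<in>UNIV. if j = q then M$p$q else 0) else 0)"
        by (intro sum.cong refl) (auto simp: if_distrib[of "(*) _"] cong: if_cong)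
      then show ?thesis by simp
    qed
    then show ?thesis by (simp add: vec_eq_iff matrix_unit_def)
  qed
  then have "F M = F (\<Sum>p\<in>UNIV. \<Sum>q\<in>UNIV. mscale (M$p$q) (matrix_unit p q))"
    by (rule arg_cong)
  then have "F M = (\<Sum>p\<in>UNIV. \<Sum>q\<in>UNIV. mscale (M$p$q) (F (matrix_unit p q)))"
    by (simp add: F_sum scl)
  then show ?thesis
    by (simp add: id_tensor_def tensor_def vec_eq_iff scaleC_sum_left scaleC_scaleC mult.commute)
qed

lemma id_tensor_add: "id_tensor F (X + Y) = id_tensor F X + id_tensor F Y"
  by (simp add: id_tensor_def tensor_def vec_eq_iff scaleC_add_right sum.distrib)

lemma id_tensor_zero: "id_tensor F 0 = 0"
  by (simp add: id_tensor_def tensor_def vec_eq_iff)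

section \<open>Matrices in an orthonormal eigenbasis\<close>

text \<open>This is the sum of \<open>G h h'\<close> tensored with the rank-one matrices built from
  \<open>v h\<close> and the conjugate of \<open>v h'\<close>, that is, \<open>G\<close> conjugated
  by the matrix whose columns are the \<open>v h\<close>.\<close>

definition in_basis ::
    "(nat \<Rightarrow> complex^'k) \<Rightarrow> (nat \<Rightarrow> nat \<Rightarrow> 'a::cstar_algebra) \<Rightarrow> 'a^'k^'k" where
  "in_basis v G = (\<chi> p q. \<Sum>h\<in>{1..CARD('k)}. \<Sum>h'\<in>{1..CARD('k)}.
     (v h $ p * cnj (v h' $ q)) *\<^sub>C G h h')"

definition diag_in_basis ::
    "(nat \<Rightarrow> complex^'k) \<Rightarrow> (nat \<Rightarrow> 'a::cstar_algebra) \<Rightarrow> 'a^'k^'k" where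
  "diag_in_basis v a = in_basis v (\<lambda>h h'. if h = h' then a h else 0)"

lemma in_basis_cong:
  fixes v :: "nat \<Rightarrow> complex^'k"
  assumes "\<And>h h'. h \<in> {1..CARD('k)} \<Longrightarrow> h' \<in> {1..CARD('k)} \<Longrightarrow> G h h' = G' h h'"
  shows "in_basis v G = in_basis v G'"
  unfolding in_basis_def using assms by (intro arg_cong[where f = vec_lambda] ext sum.cong) auto

lemma in_basis_add: "in_basis v G + in_basis v G' = in_basis v (\<lambda>h h'. G h h' + G' h h')"
  by (simp add: in_basis_def vec_eq_iff scaleC_add_right sum.distrib)

lemma mscale_in_basis: "mscale c (in_basis v G) = in_basis v (\<lambda>h h'. c *\<^sub>C G h h')"
  by (simp add: in_basis_def mscale_def vec_eq_iff scaleC_sum_right scaleC_scaleC mult_ac)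

lemma tensor_in_basis: "a \<otimes>\<^sub>m in_basis v G = in_basis v (\<lambda>h h'. G h h' *\<^sub>C a)"
  by (simp add: in_basis_def tensor_def vec_eq_iff scaleC_sum_left scaleC_scaleC)

lemma tensor_diag_in_basis: "a \<otimes>\<^sub>m diag_in_basis v c = diag_in_basis v (\<lambda>h. c h *\<^sub>C a)"
  unfolding diag_in_basis_def tensor_in_basis by (rule in_basis_cong) simp

lemma mscale_diag_in_basis: "mscale c (diag_in_basis v a) = diag_in_basis v (\<lambda>h. c *\<^sub>C a h)"
  unfolding diag_in_basis_def mscale_in_basis by (rule in_basis_cong) simp

lemma diag_in_basis_add:
  "diag_in_basis v a + diag_in_basis v b = diag_in_basis v (\<lambda>h. a h + b h)"
  unfolding diag_in_basis_def in_basis_add by (rule in_basis_cong) simp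

lemma in_basis_entry_alg:
  assumes "\<And>h h'. G h h' \<in> alg S"
  shows "in_basis v G $ p $ q \<in> alg S"
  unfolding in_basis_def by (auto intro!: alg_sum gen_alg.scl assms)

text \<open>The change of basis has scalar coefficients, so a linear \<open>g\<close> acting on the
  standard entries also acts on the entries in the eigenbasis.\<close>

lemma tensor_id_in_basis:
  assumes add: "\<And>a b. g (a + b) = g a + g b" and scl: "\<And>c a. g (c *\<^sub>C a) = c *\<^sub>C g a"
  shows "tensor_id g (in_basis v G) = in_basis v (\<lambda>h h'. g (G h h'))"
proof -
  have "g 0 = 0" using add[of 0 0] by simp
  then have "g (\<Sum>i\<in>A. a i) = (\<Sum>i\<in>A. g (a i))" for A :: "nat set" and a
    by (induction A rule: infinite_finite_induct) (auto simp: add)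
  then show ?thesis
    by (simp add: in_basis_def tensor_id_def vec_eq_iff scl)
qed

locale eigenbasis =
  fixes C :: "complex^'k^'k" and v :: "nat \<Rightarrow> complex^'k" and lam :: "nat \<Rightarrow> real"
  assumes eigenbasis: "orthonormal_eigenbasis C v lam"
begin

declare One_nat_def [simp del]

lemma orthonormal: "s \<in> {1..CARD('k)} \<Longrightarrow> t \<in> {1..CARD('k)} \<Longrightarrow> cinner (v s) (v t) = (if s = t then 1 else 0)"
  using eigenbasis by (auto simp: orthonormal_eigenbasis_def)

text \<open>Orthonormality says that the matrix with columns \<open>v h\<close> has its adjoint as
  left inverse; for a square matrix this is also a right inverse. The bijection \<open>b\<close>
  translates the numbering by naturals into the index type of the columns.\<close>

lemma completeness: "(\<Sum>h\<in>{1..CARD('k)}. v h $ p * cnj (v h $ q)) = (if p = q then 1 else 0)"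
proof -
  obtain b :: "'k \<Rightarrow> nat" where b: "bij_betw b UNIV {1..CARD('k)}"
    using finite_same_card_bij[of "UNIV :: 'k set" "{1..CARD('k)}"] by auto
  define U where "U = (\<chi> p i. v (b i) $ p)"
  have "adj U ** U = mat 1"
    using orthonormal bij_betwE[OF b] bij_betw_imp_inj_on[OF b]
    by (auto simp: vec_eq_iff matrix_matrix_mult_def mat_def U_def cinner_def inj_eq)
  then have "U ** adj U = mat 1"
    using matrix_left_right_inverse by blast
  then have "(U ** adj U) $ p $ q = mat 1 $ p $ q" by simp
  then have "(\<Sum>i\<in>UNIV. v (b i) $ p * cnj (v (b i) $ q)) = (if p = q then 1 else 0)"
    by (simp add: matrix_matrix_mult_def U_def mat_def)
  then show ?thesis
    using sum.reindex_bij_betw[OF b, of "\<lambda>h. v h $ p * cnj (v h $ q)"] by simp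
qed

lemma mat_one_eq: "mat 1 = diag_in_basis v (\<lambda>_. 1::'a::cstar_algebra)"
proof -
  have "(\<Sum>h\<in>{1..CARD('k)}. \<Sum>h'\<in>{1..CARD('k)}. (v h $ p * cnj (v h' $ q)) *\<^sub>C (if h = h' then 1 else 0)) =
      (if p = q then 1 else (0::'a))" for p q
  proof -
    have "(\<Sum>h\<in>{1..CARD('k)}. \<Sum>h'\<in>{1..CARD('k)}. (v h $ p * cnj (v h' $ q)) *\<^sub>C (if h = h' then 1 else 0)) =
        (\<Sum>h\<in>{1..CARD('k)}. \<Sum>h'\<in>{1..CARD('k)}. if h = h' then (v h $ p * cnj (v h' $ q)) *\<^sub>C (1::'a) else 0)"
      by (intro sum.cong refl) auto
    also have "\<dots> = (\<Sum>h\<in>{1..CARD('k)}. v h $ p * cnj (v h $ q)) *\<^sub>C 1"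
      by (simp add: scaleC_sum_left)
    finally show ?thesis by (simp add: completeness)
  qed
  then show ?thesis by (simp add: diag_in_basis_def in_basis_def mat_def vec_eq_iff)
qed

text \<open>The sum over the standard index \<open>k\<close> is moved innermost, where it becomes
  \<open>cinner (v j) (v i)\<close>; orthonormality then leaves only the terms with
  \<open>i = j\<close>.\<close>

lemma in_basis_mult:
  fixes G G' :: "nat \<Rightarrow> nat \<Rightarrow> 'a::cstar_algebra"
  shows "in_basis v G ** in_basis v G' = in_basis v (\<lambda>h h'. \<Sum>j\<in>{1..CARD('k)}. G h j * G' j h')"
proof -
  have "(\<Sum>k\<in>UNIV. (\<Sum>h\<in>{1..CARD('k)}. \<Sum>j\<in>{1..CARD('k)}. (v h $ p * cnj (v j $ k)) *\<^sub>C G h j) *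
          (\<Sum>i\<in>{1..CARD('k)}. \<Sum>h'\<in>{1..CARD('k)}. (v i $ k * cnj (v h' $ q)) *\<^sub>C G' i h')) =
        (\<Sum>h\<in>{1..CARD('k)}. \<Sum>h'\<in>{1..CARD('k)}. (v h $ p * cnj (v h' $ q)) *\<^sub>C (\<Sum>j\<in>{1..CARD('k)}. G h j * G' j h'))" for p q
  proof -
    have "(\<Sum>k\<in>UNIV. (\<Sum>h\<in>{1..CARD('k)}. \<Sum>j\<in>{1..CARD('k)}. (v h $ p * cnj (v j $ k)) *\<^sub>C G h j) *
          (\<Sum>i\<in>{1..CARD('k)}. \<Sum>h'\<in>{1..CARD('k)}. (v i $ k * cnj (v h' $ q)) *\<^sub>C G' i h')) =
        (\<Sum>k\<in>UNIV. \<Sum>h\<in>{1..CARD('k)}. \<Sum>j\<in>{1..CARD('k)}. \<Sum>i\<in>{1..CARD('k)}. \<Sum>h'\<in>{1..CARD('k)}.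
          (cnj (v j $ k) * v i $ k) *\<^sub>C (v h $ p * cnj (v h' $ q)) *\<^sub>C (G h j * G' i h'))"
      unfolding sum_distrib_right unfolding sum_distrib_left
      by (intro sum.cong refl)
        (simp add: scaleC_mult_left scaleC_mult_right scaleC_scaleC mult_ac)
    also have "\<dots> = (\<Sum>h\<in>{1..CARD('k)}. \<Sum>j\<in>{1..CARD('k)}. \<Sum>i\<in>{1..CARD('k)}. \<Sum>h'\<in>{1..CARD('k)}. \<Sum>k\<in>UNIV.
          (cnj (v j $ k) * v i $ k) *\<^sub>C (v h $ p * cnj (v h' $ q)) *\<^sub>C (G h j * G' i h'))"
      by (simp only: sum.swap[of _ "{1..CARD('k)}" "UNIV::'k set"])
    also have "\<dots> = (\<Sum>h\<in>{1..CARD('k)}. \<Sum>j\<in>{1..CARD('k)}. \<Sum>i\<in>{1..CARD('k)}. \<Sum>h'\<in>{1..CARD('k)}.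
          cinner (v j) (v i) *\<^sub>C (v h $ p * cnj (v h' $ q)) *\<^sub>C (G h j * G' i h'))"
      by (simp add: cinner_def scaleC_sum_left)
    also have "\<dots> = (\<Sum>h\<in>{1..CARD('k)}. \<Sum>j\<in>{1..CARD('k)}. \<Sum>i\<in>{1..CARD('k)}. if j = i then
          (\<Sum>h'\<in>{1..CARD('k)}. (v h $ p * cnj (v h' $ q)) *\<^sub>C (G h j * G' i h')) else 0)"
    proof (intro sum.cong refl)
      fix h j i assume "j \<in> {1..CARD('k)}" "i \<in> {1..CARD('k)}"
      then show "(\<Sum>h'\<in>{1..CARD('k)}.
            cinner (v j) (v i) *\<^sub>C (v h $ p * cnj (v h' $ q)) *\<^sub>C (G h j * G' i h')) =
          (if j = i then \<Sum>h'\<in>{1..CARD('k)}. (v h $ p * cnj (v h' $ q)) *\<^sub>C (G h j * G' i h')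
           else 0)"
        by (simp add: orthonormal)
    qed
    also have "\<dots> = (\<Sum>h\<in>{1..CARD('k)}. \<Sum>j\<in>{1..CARD('k)}. \<Sum>h'\<in>{1..CARD('k)}. (v h $ p * cnj (v h' $ q)) *\<^sub>C (G h j * G' j h'))"
      by (rule sum.cong[OF refl], rule sum.cong[OF refl]) simp
    also have "\<dots> = (\<Sum>h\<in>{1..CARD('k)}. \<Sum>h'\<in>{1..CARD('k)}. \<Sum>j\<in>{1..CARD('k)}. (v h $ p * cnj (v h' $ q)) *\<^sub>C (G h j * G' j h'))"
      by (intro sum.cong refl sum.swap)
    finally show ?thesis by (simp only: scaleC_sum_right)
  qed
  then show ?thesis
    by (simp add: in_basis_def matrix_matrix_mult_def vec_eq_iff)
qed

lemma diag_in_basis_mult_in_basis: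
  "diag_in_basis v a ** in_basis v G = in_basis v (\<lambda>h h'. a h * G h h')"
  unfolding diag_in_basis_def in_basis_mult
proof (rule in_basis_cong)
  fix h h' assume "h \<in> {1..CARD('k)}"
  have "(\<Sum>j\<in>{1..CARD('k)}. (if h = j then a h else 0) * G j h') = (\<Sum>j\<in>{1..CARD('k)}. if h = j then a h * G j h' else 0)"
    by (intro sum.cong) auto
  then show "(\<Sum>j\<in>{1..CARD('k)}. (if h = j then a h else 0) * G j h') = a h * G h h'"
    using \<open>h \<in> {1..CARD('k)}\<close> by simp
qed

lemma diag_in_basis_mult:
  "diag_in_basis v a ** diag_in_basis v b = diag_in_basis v (\<lambda>h. a h * b h)"
  unfolding diag_in_basis_def[of v b] diag_in_basis_mult_in_basis
  unfolding diag_in_basis_def by (rule in_basis_cong) simp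

text \<open>Spectral decomposition: insert the completeness relation to the right of
  \<open>C\<close> and apply the eigenvalue equation.\<close>

lemma C_eq: "C = diag_in_basis v (\<lambda>h. complex_of_real (lam h))"
proof -
  have "C $ p $ q = (\<Sum>h\<in>{1..CARD('k)}. of_real (lam h) * (v h $ p * cnj (v h $ q)))" for p q
  proof -
    have "C $ p $ q = (\<Sum>k\<in>UNIV. C $ p $ k * (\<Sum>h\<in>{1..CARD('k)}. v h $ k * cnj (v h $ q)))"
      unfolding completeness by (simp add: if_distrib[of "(*) _"] cong: if_cong)
    also have "\<dots> = (\<Sum>h\<in>{1..CARD('k)}. (C *v v h) $ p * cnj (v h $ q))"
      unfolding sum_distrib_left matrix_vector_mult_def
      by (subst sum.swap) (simp add: sum_distrib_left mult_ac)
    also have "\<dots> = (\<Sum>h\<in>{1..CARD('k)}. of_real (lam h) * (v h $ p * cnj (v h $ q)))"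
    proof (rule sum.cong)
      fix h assume "h \<in> {1..CARD('k)}"
      then have "C *v v h = of_real (lam h) *s v h"
        using eigenbasis unfolding orthonormal_eigenbasis_def by blast
      then show "(C *v v h) $ p * cnj (v h $ q) = of_real (lam h) * (v h $ p * cnj (v h $ q))"
        by simp
    qed simp
    finally show ?thesis .
  qed
  moreover have "(\<Sum>h\<in>{1..CARD('k)}. \<Sum>h'\<in>{1..CARD('k)}. (v h $ p * cnj (v h' $ q)) * (if h = h' then of_real (lam h) else 0)) =
      (\<Sum>h\<in>{1..CARD('k)}. of_real (lam h) * (v h $ p * cnj (v h $ q)))" for p q
  proof (rule sum.cong)
    fix h assume "h \<in> {1..CARD('k)}"
    have "(\<Sum>h'\<in>{1..CARD('k)}. (v h $ p * cnj (v h' $ q)) * (if h = h' then of_real (lam h) else 0)) =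
        (\<Sum>h'\<in>{1..CARD('k)}. if h = h' then (v h $ p * cnj (v h' $ q)) * of_real (lam h) else 0)"
      by (intro sum.cong) auto
    then show "(\<Sum>h'\<in>{1..CARD('k)}. (v h $ p * cnj (v h' $ q)) * (if h = h' then of_real (lam h) else 0)) =
        of_real (lam h) * (v h $ p * cnj (v h $ q))"
      using \<open>h \<in> {1..CARD('k)}\<close> by (simp add: mult_ac)
  qed simp
  ultimately show ?thesis
    by (simp add: vec_eq_iff diag_in_basis_def in_basis_def)
qed

text \<open>The eigenvalues are real. Self-adjointness is what guarantees a unique trace-preserving
  conditional expectation onto the algebra of \<open>C\<close>.\<close>

lemma adj_C: "adj C = C"
proof -
  have "cnj (\<Sum>h\<in>{1..CARD('k)}. \<Sum>h'\<in>{1..CARD('k)}. (v h $ q * cnj (v h' $ p)) * (if h = h' then of_real (lam h) else 0)) =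
      (\<Sum>h\<in>{1..CARD('k)}. \<Sum>h'\<in>{1..CARD('k)}. (v h $ p * cnj (v h' $ q)) * (if h = h' then of_real (lam h) else 0))" for p q
    by (simp, subst sum.swap) (auto intro!: sum.cong)
  then show ?thesis
    by (subst (1 2) C_eq) (simp add: vec_eq_iff diag_in_basis_def in_basis_def)
qed

text \<open>Functions of the eigenvalue are polynomials in \<open>C\<close> by Lagrange interpolation.\<close>

lemma eigenvalue_function_in_mat_alg: "diag_in_basis v (\<lambda>h. \<mu> (lam h)) \<in> mat_alg {C}"
proof -
  define T where "T = lam ` {1..CARD('k)}"
  have T: "finite T" by (simp add: T_def)
  define D where "D = (\<lambda>\<mu> :: real \<Rightarrow> complex. diag_in_basis v (\<lambda>h. \<mu> (lam h)))"
  have one: "D (\<lambda>_. 1) \<in> mat_alg {C}"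
    by (simp add: D_def flip: mat_one_eq) (rule gen_alg.one)
  have id: "D of_real \<in> mat_alg {C}"
    by (simp add: D_def flip: C_eq) (rule gen_alg.gen, simp)
  have scl: "D (\<lambda>y. c * \<mu> y) \<in> mat_alg {C}" if "D \<mu> \<in> mat_alg {C}" for c \<mu>
    using gen_alg.scl[OF that, of c] by (simp add: D_def mscale_diag_in_basis)
  have add: "D (\<lambda>y. \<mu> y + \<nu> y) \<in> mat_alg {C}" if "D \<mu> \<in> mat_alg {C}" "D \<nu> \<in> mat_alg {C}" for \<mu> \<nu>
    using gen_alg.add[OF that] by (simp add: D_def diag_in_basis_add)
  have mul: "D (\<lambda>y. \<mu> y * \<nu> y) \<in> mat_alg {C}" if "D \<mu> \<in> mat_alg {C}" "D \<nu> \<in> mat_alg {C}" for \<mu> \<nu>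
    using gen_alg.mul[OF that] by (simp add: D_def diag_in_basis_mult)
  have prod: "D (\<lambda>y. \<Prod>\<sigma>\<in>A. \<mu> \<sigma> y) \<in> mat_alg {C}"
    if "\<And>\<sigma>. \<sigma> \<in> A \<Longrightarrow> D (\<mu> \<sigma>) \<in> mat_alg {C}" "finite A" for A :: "real set" and \<mu>
    using that(2,1) by induction (auto intro: one mul)
  have sum: "D (\<lambda>y. \<Sum>\<sigma>\<in>A. \<mu> \<sigma> y) \<in> mat_alg {C}"
    if "\<And>\<sigma>. \<sigma> \<in> A \<Longrightarrow> D (\<mu> \<sigma>) \<in> mat_alg {C}" "finite A" for A :: "real set" and \<mu>
    using that(2,1) scl[OF one, of 0] by induction (auto intro: add)
  \<comment> \<open>The Lagrange basis polynomial of the node \<open>\<rho>\<close> among the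
    eigenvalues in \<open>T\<close>. Each factor is a scalar times the identity function plus a
    constant, the shape that \<open>scl\<close>, \<open>add\<close>, \<open>id\<close> and
    \<open>one\<close> build.\<close>
  define \<Lambda> where "\<Lambda> = (\<lambda>\<rho> y. \<Prod>\<sigma>\<in>T-{\<rho>}. inverse (of_real \<rho> - of_real \<sigma>) * (of_real y + (- of_real \<sigma>) * 1 :: complex))"
  have "D (\<lambda>y. \<Sum>\<rho>\<in>T. \<mu> \<rho> * \<Lambda> \<rho> y) \<in> mat_alg {C}"
    unfolding \<Lambda>_def using T by (intro sum scl prod add id one) auto
  moreover have "(\<Sum>\<rho>\<in>T. \<mu> \<rho> * \<Lambda> \<rho> y) = \<mu> y" if "y \<in> T" for y
  proof -
    have "\<Lambda> \<rho> y = (if y = \<rho> then 1 else 0)" if "\<rho> \<in> T" for \<rho>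
    proof (cases "y = \<rho>")
      case True
      then show ?thesis unfolding \<Lambda>_def by (auto intro!: prod.neutral)
    next
      case False
      then show ?thesis using T \<open>y \<in> T\<close> by (auto simp: \<Lambda>_def intro!: bexI[of _ y])
    qed
    then have "(\<Sum>\<rho>\<in>T. \<mu> \<rho> * \<Lambda> \<rho> y) = (\<Sum>\<rho>\<in>T. if y = \<rho> then \<mu> \<rho> else 0)"
      by (intro sum.cong) auto
    then show ?thesis using T that by simp
  qed
  \<comment> \<open>Agreement on \<open>T\<close> suffices, since the matrix evaluates the function
    at eigenvalues only.\<close>
  ultimately show ?thesis
    by (auto simp: D_def T_def diag_in_basis_def cong: in_basis_cong
        elim!: back_subst[where P = "\<lambda>X. X \<in> _"] intro!: in_basis_cong)
qed

lemma trace_cond_exp: "is_trace_cond_exp (mat_alg {C}) (trace_cond_exp (mat_alg {C}))"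
  unfolding trace_cond_exp_def by (rule theI'[OF trace_cond_exp_unique_existence[OF adj_C]])

text \<open>The matrix is \<open>a\<close> tensored with a function of \<open>C\<close> plus
  \<open>b\<close> tensored with another one; both functions lie in the algebra of \<open>C\<close>,
  which the conditional expectation fixes.\<close>

lemma id_tensor_trace_cond_exp_fixes:
  "id_tensor (trace_cond_exp (mat_alg {C}))
     (diag_in_basis v (\<lambda>h. \<alpha> (lam h) *\<^sub>C a + \<beta> (lam h) *\<^sub>C b)) =
   diag_in_basis v (\<lambda>h. \<alpha> (lam h) *\<^sub>C a + \<beta> (lam h) *\<^sub>C b)" (is "id_tensor ?F _ = _")
proof -
  have F: "?F (X + Y) = ?F X + ?F Y" "?F (mscale c X) = mscale c (?F X)" for c X Y
    using trace_cond_exp unfolding is_trace_cond_exp_def by blast+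
  have F_diag: "?F (diag_in_basis v (\<lambda>h. \<mu> (lam h))) = diag_in_basis v (\<lambda>h. \<mu> (lam h))" for \<mu>
    using trace_cond_exp eigenvalue_function_in_mat_alg unfolding is_trace_cond_exp_def by blast
  show ?thesis
    unfolding diag_in_basis_add[symmetric] tensor_diag_in_basis[symmetric] id_tensor_add
      id_tensor_tensor[of ?F, OF F] F_diag ..
qed

end

section \<open>Freeness from entrywise centred matrices\<close>

lemma foldr_mult: "foldr (*) xs (a::'a::monoid_mult) = foldr (*) xs 1 * a"
  by (induction xs) (simp_all add: mult.assoc)

text \<open>An entry of a matrix product is a sum of words of entries. The list \<open>ys\<close>
  holds the entries already chosen; the induction appends to it one entry of the next matrix, until
  only an entry of \<open>mat 1\<close>, which is 0 or 1, remains.\<close>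

lemma free_amalg_matrix_product:
  fixes g :: "'a::cstar_algebra \<Rightarrow> 'a" and Xs :: "(bool \<times> ('a^'k^'k)) list"
  assumes free: "free_amalg 1 (*) g A1 A2"
    and add: "\<And>a b. g (a + b) = g a + g b"
    and Xs: "\<And>b X p q. (b, X) \<in> set Xs \<Longrightarrow> X $ p $ q \<in> (if b then A1 else A2) \<and> g (X $ p $ q) = 0"
    and ys: "\<And>b a. (b, a) \<in> set ys \<Longrightarrow> a \<in> (if b then A1 else A2) \<and> g a = 0"
    and "distinct_adj (map fst ys @ map fst Xs)"
    and "ys \<noteq> [] \<or> Xs \<noteq> []"
  shows "g (foldr (*) (map snd ys) 1 * foldr (**) (map snd Xs) (mat 1) $ p $ q) = 0"
  using assms(3-)
proof (induction Xs arbitrary: ys p)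
  case Nil
  have "g 0 = 0" using add[of 0 0] by simp
  moreover have "g (foldr (*) (map snd ys) 1) = 0"
    using free Nil unfolding free_amalg_def by fastforce
  ultimately show ?case by (simp add: mat_def)
next
  case (Cons bX Xs)
  obtain b X where bX: "bX = (b, X)" by force
  define R where "R = foldr (**) (map snd Xs) (mat 1)"
  have "g 0 = 0" using add[of 0 0] by simp
  then have g_sum: "g (\<Sum>k\<in>K. a k) = (\<Sum>k\<in>K. g (a k))" for a and K :: "'k set"
    by (induction K rule: infinite_finite_induct) (auto simp: add)
  have "g (foldr (*) (map snd ys) 1 * (X $ p $ k * R $ k $ q)) = 0" for k
  proof -
    \<comment> \<open>The tag \<open>b\<close> moves from the matrices to the chosen entries, so the
      joint list of tags is unchanged and still alternates.\<close>
    have "g (foldr (*) (map snd (ys @ [(b, X $ p $ k)])) 1 * R $ k $ q) = 0"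
      unfolding R_def
    proof (rule Cons.IH)
      show "c \<in> (if b' then A1 else A2) \<and> g c = 0"
        if "(b', c) \<in> set (ys @ [(b, X $ p $ k)])" for b' c
        using that Cons.prems(1)[of b X p k] Cons.prems(2)[of b' c] by (auto simp: bX)
    qed (use Cons.prems(1,3) in \<open>auto simp: bX\<close>)
    then show ?thesis
      using foldr_mult[of "map snd ys" "X $ p $ k"] by (simp add: mult.assoc)
  qed
  moreover have "foldr (**) (map snd (bX # Xs)) (mat 1) $ p $ q = (X ** R) $ p $ q"
    by (simp add: bX R_def)
  moreover have "(X ** R) $ p $ q = (\<Sum>k\<in>UNIV. X $ p $ k * R $ k $ q)"
    by (simp add: matrix_matrix_mult_def)
  ultimately show ?case
    by (simp only: sum_distrib_left g_sum) simp
qed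

section \<open>Linearity of the trace and of \<open>psi\<close>\<close>

lemma tracial_state_add: "tracial_state \<tau> \<Longrightarrow> \<tau> (a + b) = \<tau> a + \<tau> b"
  and tracial_state_scaleC: "tracial_state \<tau> \<Longrightarrow> \<tau> (c *\<^sub>C a) = c * \<tau> a"
  and tracial_state_commute: "tracial_state \<tau> \<Longrightarrow> \<tau> (a * b) = \<tau> (b * a)"
  unfolding tracial_state_def Vector_Spaces.linear_iff by auto

lemma psi_add: "tracial_state \<tau> \<Longrightarrow> psi \<tau> e (a + b) = psi \<tau> e a + psi \<tau> e b"
  by (simp add: psi_def distrib_left tracial_state_add scaleC_add_left)

lemma psi_scaleC: "tracial_state \<tau> \<Longrightarrow> psi \<tau> e (c *\<^sub>C a) = c *\<^sub>C psi \<tau> e a"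
  by (simp add: psi_def scaleC_mult_right tracial_state_scaleC scaleC_add_right scaleC_scaleC mult_ac)

lemma psi_zero: "tracial_state \<tau> \<Longrightarrow> psi \<tau> e 0 = 0"
  using psi_scaleC[of \<tau> e 0 0] by simp

section \<open>The two algebras\<close>

locale choi_setting = eigenbasis C v lam
  for C :: "complex^('n::finite \<times> 'm::finite)^('n \<times> 'm)" and v lam +
  fixes \<tau> :: "'a::cstar_algebra \<Rightarrow> complex"
    and e :: "'m + 'n \<Rightarrow> 'm + 'n \<Rightarrow> 'a"
  assumes tracial_state: "tracial_state \<tau>"
    and units: "unital_matrix_units e"
    and well_behaved: "tracially_well_behaved \<tau> e v lam"
begin

abbreviation w :: "nat \<Rightarrow> 'a" where "w \<equiv> w_elem e v"
abbreviation Q :: "real \<Rightarrow> 'a" where "Q \<equiv> Q_elem e v lam"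

lemma e_mult: "e i j * e k l = (if j = k then e i l else 0)"
  and star_e: "star (e i j) = e j i"
  using units by (auto simp: unital_matrix_units_def)

lemma pm_mult_pn [simp]: "pm e * pn e = 0" and pn_mult_pm [simp]: "pn e * pm e = 0"
  and pm_mult_pm [simp]: "pm e * pm e = pm e" and pn_mult_pn [simp]: "pn e * pn e = pn e"
  by (simp_all add: pm_def pn_def sum_distrib_left sum_distrib_right e_mult)

text \<open>The column index of each \<open>e (Inr i) (Inl j)\<close> lies in the first block. Hence
  every product \<open>star (w h) * g * w h'\<close> lies in the corner of
  \<open>pm e\<close>.\<close>

lemma w_mult_pm [simp]: "w s * pm e = w s" and w_mult_pn [simp]: "w s * pn e = 0"
  by (simp_all add: w_elem_def pm_def pn_def sum_distrib_left sum_distrib_right e_mult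
      scaleC_mult_left if_distrib[of "scaleC _"] cong: if_cong) (rule sum.swap)

lemma pm_mult_star_w [simp]: "pm e * star (w s) = star (w s)"
  and pn_mult_star_w [simp]: "pn e * star (w s) = 0"
proof -
  have "star (pm e) = pm e" "star (pn e) = pn e"
    by (simp_all add: pm_def pn_def star_sum star_e)
  then show "pm e * star (w s) = star (w s)" "pn e * star (w s) = 0"
    using star_mult[of "w s" "pm e"] star_mult[of "w s" "pn e"] star_scaleC[of 0 "0::'a"]
    by simp_all
qed

lemma w_in_alg: "w s \<in> alg {e i j | i j. True}" "star (w s) \<in> alg {e i j | i j. True}"
proof -
  show "w s \<in> alg {e i j | i j. True}"
    unfolding w_elem_def by (intro alg_sum gen_alg.scl gen_alg.gen) blast
  show "star (w s) \<in> alg {e i j | i j. True}"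
    unfolding w_elem_def star_sum star_scaleC star_e by (intro alg_sum gen_alg.scl gen_alg.gen) blast
qed

lemma amalg_generators:
  "pm e \<otimes>\<^sub>m mat 1 = diag_in_basis v (\<lambda>_. pm e)"
  "pn e \<otimes>\<^sub>m mat 1 = diag_in_basis v (\<lambda>_. pn e)"
  "y \<otimes>\<^sub>m C = diag_in_basis v (\<lambda>h. complex_of_real (lam h) *\<^sub>C y)"
  unfolding mat_one_eq by (simp_all add: tensor_diag_in_basis) (subst C_eq, rule tensor_diag_in_basis)

text \<open>If applying \<open>psi\<close> entrywise already gives a matrix fixed by the second
  expectation, then the vanishing of the composed expectation is vanishing of \<open>psi\<close> on
  every entry.\<close>

lemma amalg_exp_zero:
  assumes E: "amalg_exp \<tau> e C X = 0"
    and X: "tensor_id (psi \<tau> e) X = diag_in_basis v (\<lambda>h. \<alpha> (lam h) *\<^sub>C pm e + \<beta> (lam h) *\<^sub>C pn e)"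
  shows "psi \<tau> e (X $ p $ q) = 0"
proof -
  have "tensor_id (psi \<tau> e) X = 0"
    using E unfolding amalg_exp_def comp_def X id_tensor_trace_cond_exp_fixes .
  then have "tensor_id (psi \<tau> e) X $ p $ q = 0" by simp
  then show ?thesis by (simp add: tensor_id_def)
qed

section \<open>The algebra generated by \<open>x \<otimes>\<^sub>m C\<close>\<close>

text \<open>All generators are diagonal in the eigenbasis and diagonal matrices multiply pointwise.
  Taking \<open>a\<close> as a function of the eigenvalue, not of the index, records constancy on
  eigenspaces.\<close>

lemma first_algebra_form:
  assumes "X \<in> mat_alg ({x \<otimes>\<^sub>m C} \<union> amalg_alg e C)"
  shows "\<exists>a. (\<forall>\<rho>. a \<rho> \<in> alg ({x} \<union> alg {pm e, pn e})) \<and> X = diag_in_basis v (\<lambda>h. a (lam h))"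
proof -
  let ?A = "alg ({x} \<union> alg {pm e, pn e})"
  let ?L = "{diag_in_basis v (\<lambda>h. a (lam h)) | a. \<forall>\<rho>. a \<rho> \<in> ?A}"
  have mem: "x \<in> ?A" "pm e \<in> ?A" "pn e \<in> ?A" "1 \<in> ?A"
    by (auto intro: gen_alg.intros)
  have left: "diag_in_basis v (\<lambda>h. b (lam h)) ** Y \<in> ?L" if b: "\<And>\<rho>. b \<rho> \<in> ?A" and Y: "Y \<in> ?L" for b Y
  proof -
    obtain a where a: "\<And>\<rho>. a \<rho> \<in> ?A" "Y = diag_in_basis v (\<lambda>h. a (lam h))"
      using Y by blast
    show ?thesis
      using b a(1) unfolding a(2) diag_in_basis_mult
      by (intro CollectI exI[of _ "\<lambda>\<rho>. b \<rho> * a \<rho>"]) (auto intro: gen_alg.mul)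
  qed
  have "mat_alg ({x \<otimes>\<^sub>m C} \<union> amalg_alg e C) \<subseteq> ?L"
  proof (rule mat_alg_amalg_subset)
    fix X Y assume X: "X \<in> {x \<otimes>\<^sub>m C}" and Y: "Y \<in> ?L"
    show "X ** Y \<in> ?L"
      using X left[OF _ Y, of "\<lambda>\<rho>. complex_of_real \<rho> *\<^sub>C x"] mem
      by (simp add: amalg_generators gen_alg.scl)
  next
    fix Y assume Y: "Y \<in> ?L"
    show "(pm e \<otimes>\<^sub>m mat 1) ** Y \<in> ?L" "(pn e \<otimes>\<^sub>m mat 1) ** Y \<in> ?L" "(1 \<otimes>\<^sub>m C) ** Y \<in> ?L"
      unfolding amalg_generators
      using left[OF _ Y, of "\<lambda>_. pm e"] left[OF _ Y, of "\<lambda>_. pn e"]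
        left[OF _ Y, of "\<lambda>\<rho>. complex_of_real \<rho> *\<^sub>C 1"] mem
      by (auto intro: gen_alg.scl)
  next
    show "mat 1 \<in> ?L"
      unfolding mat_one_eq using mem by (intro CollectI exI[of _ "\<lambda>_. 1"]) simp
  next
    fix Y Z assume "Y \<in> ?L" "Z \<in> ?L"
    then obtain a b where ab: "\<And>\<rho>. a \<rho> \<in> ?A" "Y = diag_in_basis v (\<lambda>h. a (lam h))"
      "\<And>\<rho>. b \<rho> \<in> ?A" "Z = diag_in_basis v (\<lambda>h. b (lam h))" by blast
    show "Y + Z \<in> ?L"
      using ab(1,3) unfolding ab(2,4) diag_in_basis_add
      by (intro CollectI exI[of _ "\<lambda>\<rho>. a \<rho> + b \<rho>"]) (auto intro: gen_alg.add)
  next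
    fix c Y assume "Y \<in> ?L"
    then obtain a where a: "\<And>\<rho>. a \<rho> \<in> ?A" "Y = diag_in_basis v (\<lambda>h. a (lam h))" by blast
    show "mscale c Y \<in> ?L"
      using a(1) unfolding a(2) mscale_diag_in_basis
      by (intro CollectI exI[of _ "\<lambda>\<rho>. c *\<^sub>C a \<rho>"]) (auto intro: gen_alg.scl)
  qed
  then show ?thesis using assms by blast
qed

lemma first_algebra_entries:
  assumes X: "X \<in> mat_alg ({x \<otimes>\<^sub>m C} \<union> amalg_alg e C)" and E: "amalg_exp \<tau> e C X = 0"
  shows "X $ p $ q \<in> alg ({x} \<union> alg {pm e, pn e})" "psi \<tau> e (X $ p $ q) = 0"
proof -
  obtain a where a: "\<And>\<rho>. a \<rho> \<in> alg ({x} \<union> alg {pm e, pn e})"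
    and X_eq: "X = diag_in_basis v (\<lambda>h. a (lam h))"
    using first_algebra_form[OF X] by blast
  have zero: "0 \<in> alg ({x} \<union> alg {pm e, pn e})"
    using alg_sum[of "{}"] by simp
  show "X $ p $ q \<in> alg ({x} \<union> alg {pm e, pn e})"
    unfolding X_eq diag_in_basis_def using a zero by (intro in_basis_entry_alg) simp
  \<comment> \<open>The coefficients of \<open>pm e\<close> and \<open>pn e\<close> in
    \<open>psi \<tau> e (a \<rho>)\<close>, which depend on the eigenvalue only.\<close>
  define \<alpha> \<beta> where "\<alpha> = (\<lambda>\<rho>. inverse (\<tau> (pm e)) * \<tau> (pm e * a \<rho>))"
    and "\<beta> = (\<lambda>\<rho>. inverse (\<tau> (pn e)) * \<tau> (pn e * a \<rho>))"
  have "psi \<tau> e (a \<rho>) = \<alpha> \<rho> *\<^sub>C pm e + \<beta> \<rho> *\<^sub>C pn e" for \<rho>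
    by (simp add: psi_def \<alpha>_def \<beta>_def)
  then have "tensor_id (psi \<tau> e) X = diag_in_basis v (\<lambda>h. \<alpha> (lam h) *\<^sub>C pm e + \<beta> (lam h) *\<^sub>C pn e)"
    unfolding X_eq diag_in_basis_def
      tensor_id_in_basis[of "psi \<tau> e", OF psi_add[OF tracial_state] psi_scaleC[OF tracial_state]]
    by (intro in_basis_cong) (simp add: psi_zero[OF tracial_state])
  then show "psi \<tau> e (X $ p $ q) = 0"
    by (rule amalg_exp_zero[OF E, of \<alpha> \<beta>])
qed

section \<open>Traces against polynomials in the \<open>Q \<rho>\<close>\<close>

abbreviation Q_alg :: "'a set" where "Q_alg \<equiv> alg (Q ` (lam ` {1..CARD('n \<times> 'm)} - {0}))"

lemma trace_w_Q_word:
  assumes "set \<rho>s \<subseteq> lam ` {1..CARD('n \<times> 'm)} - {0}"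
    and "j \<in> {1..CARD('n \<times> 'm)}" "j' \<in> {1..CARD('n \<times> 'm)}" "k \<in> {1..CARD('n \<times> 'm)}"
    and "lam j = lam j'" "lam j \<noteq> 0"
  shows "\<tau> (w j * star (w k) * prod_list (map Q \<rho>s)) =
    (if j = k then \<tau> (w j' * star (w j') * prod_list (map Q \<rho>s)) else 0)"
proof (cases "j = k")
  case True
  then show ?thesis
    using well_behaved[unfolded tracially_well_behaved_def Let_def, rule_format,
        OF assms(1-4) conjI[OF assms(5,6)]] by simp
next
  case False
  then show ?thesis
    using well_behaved[unfolded tracially_well_behaved_def Let_def, rule_format,
        OF assms(1-4) conjI[OF assms(5,6)]] by simp
qed

text \<open>The identity is linear in \<open>g\<close>, so it passes from words in the
  \<open>Q \<rho>\<close> to the algebra they generate.\<close>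

lemma trace_w_Q_alg:
  assumes g: "g \<in> Q_alg"
    and j: "j \<in> {1..CARD('n \<times> 'm)}" "j' \<in> {1..CARD('n \<times> 'm)}" "k \<in> {1..CARD('n \<times> 'm)}"
    and lam: "lam j = lam j'" "lam j \<noteq> 0"
  shows "\<tau> (w j * star (w k) * g) = (if j = k then \<tau> (w j' * star (w j') * g) else 0)"
proof -
  define P where "P g \<longleftrightarrow>
    \<tau> (w j * star (w k) * g) = (if j = k then \<tau> (w j' * star (w j') * g) else 0)" for g
  \<comment> \<open>The claim is demanded behind every word: a generator multiplied from the left is
    then absorbed as the last letter of that word.\<close>
  define L where
    "L = {g. \<forall>\<rho>s. set \<rho>s \<subseteq> lam ` {1..CARD('n \<times> 'm)} - {0} \<longrightarrow> P (prod_list (map Q \<rho>s) * g)}"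
  have "g * 1 \<in> L"
  proof (rule alg_mul_closed[OF g])
    show "1 \<in> L"
      unfolding L_def
    proof (intro CollectI allI impI)
      fix \<rho>s assume "set \<rho>s \<subseteq> lam ` {1..CARD('n \<times> 'm)} - {0}"
      then show "P (prod_list (map Q \<rho>s) * 1)"
        unfolding P_def mult.right_neutral by (intro trace_w_Q_word j lam)
    qed
  next
    fix a b assume "a \<in> Q ` (lam ` {1..CARD('n \<times> 'm)} - {0})" and b: "b \<in> L"
    then obtain \<rho> where \<rho>: "\<rho> \<in> lam ` {1..CARD('n \<times> 'm)} - {0}" and a: "a = Q \<rho>" by blast
    show "a * b \<in> L"
      unfolding L_def
    proof (intro CollectI allI impI)
      fix \<rho>s assume "set \<rho>s \<subseteq> lam ` {1..CARD('n \<times> 'm)} - {0}"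
      then have "set (\<rho>s @ [\<rho>]) \<subseteq> lam ` {1..CARD('n \<times> 'm)} - {0}" using \<rho> by simp
      then have "P (prod_list (map Q (\<rho>s @ [\<rho>])) * b)" using b unfolding L_def by blast
      then show "P (prod_list (map Q \<rho>s) * (a * b))" by (simp add: a mult.assoc)
    qed
  next
    have "P (a + b)" if "P a" "P b" for a b
      using that unfolding P_def by (simp add: distrib_left tracial_state_add[OF tracial_state])
    then show "a + b \<in> L" if "a \<in> L" "b \<in> L" for a b
      using that by (simp add: L_def distrib_left)
    have "P (c *\<^sub>C a)" if "P a" for c a
      using that unfolding P_def
      by (simp add: scaleC_mult_right tracial_state_scaleC[OF tracial_state])
    then show "c *\<^sub>C a \<in> L" if "a \<in> L" for c a
      using that by (simp add: L_def scaleC_mult_right)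
  qed
  then have "set [] \<subseteq> lam ` {1..CARD('n \<times> 'm)} - {0} \<longrightarrow> P (prod_list (map Q []) * (g * 1))"
    unfolding L_def by blast
  then show ?thesis by (simp add: P_def)
qed

section \<open>The algebra generated by \<open>outer (f_vec e v lam)\<close>\<close>

text \<open>The value 0 outside non-zero eigenvalues reflects that \<open>f_vec\<close> sums only
  over eigenvectors with non-zero eigenvalue.\<close>

definition w_sandwich :: "(real \<Rightarrow> real \<Rightarrow> 'a) \<Rightarrow> nat \<Rightarrow> nat \<Rightarrow> 'a" where
  "w_sandwich g h h' =
     (if lam h \<noteq> 0 \<and> lam h' \<noteq> 0 then star (w h) * g (lam h) (lam h') * w h' else 0)"

lemma outer_f: "outer (f_vec e v lam) = in_basis v (w_sandwich (\<lambda>_ _. 1))"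
proof -
  let ?I = "{1..CARD('n \<times> 'm)}"
  \<comment> \<open>Zero terms extend the sum to all indices, the range used by
    \<open>in_basis\<close>.\<close>
  have f: "f_vec e v lam $ p = (\<Sum>s\<in>?I. v s $ p *\<^sub>C (if lam s \<noteq> 0 then star (w s) else 0))" for p
  proof -
    have "f_vec e v lam $ p = (\<Sum>s\<in>{s\<in>?I. lam s \<noteq> 0}. v s $ p *\<^sub>C star (w s))"
      by (simp add: f_vec_def tensor_vec_def)
    also have "\<dots> = (\<Sum>s\<in>?I. v s $ p *\<^sub>C (if lam s \<noteq> 0 then star (w s) else 0))"
      by (rule sum.mono_neutral_cong_left) auto
    finally show ?thesis .
  qed
  have "star (0::'a) = 0" using star_scaleC[of 0 "0::'a"] by simp
  then have "f_vec e v lam $ p * star (f_vec e v lam $ q) =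
      (\<Sum>h\<in>?I. \<Sum>h'\<in>?I. (v h $ p * cnj (v h' $ q)) *\<^sub>C w_sandwich (\<lambda>_ _. 1) h h')" for p q
    unfolding f star_sum sum_product
    by (intro sum.cong refl)
      (simp add: star_scaleC star_star scaleC_mult_left scaleC_mult_right scaleC_scaleC w_sandwich_def mult.commute)
  then show ?thesis by (simp add: outer_def in_basis_def vec_eq_iff)
qed

definition second_matrix :: "(real \<Rightarrow> complex) \<Rightarrow> (real \<Rightarrow> complex) \<Rightarrow> (real \<Rightarrow> real \<Rightarrow> 'a) \<Rightarrow>
    'a^('n \<times> 'm)^('n \<times> 'm)" where
  "second_matrix \<alpha> \<beta> g = diag_in_basis v (\<lambda>h. \<alpha> (lam h) *\<^sub>C pm e + \<beta> (lam h) *\<^sub>C pn e) +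
     in_basis v (w_sandwich g)"

text \<open>\<open>star (w h)\<close> absorbs \<open>pm e\<close> and is annihilated by
  \<open>pn e\<close> from the left, so only \<open>\<gamma>\<close> reaches the middle factor
  \<open>g\<close>.\<close>

lemma second_matrix_left:
  "diag_in_basis v (\<lambda>h. \<gamma> (lam h) *\<^sub>C pm e + \<delta> (lam h) *\<^sub>C pn e) ** second_matrix \<alpha> \<beta> g =
   second_matrix (\<lambda>\<rho>. \<gamma> \<rho> * \<alpha> \<rho>) (\<lambda>\<rho>. \<delta> \<rho> * \<beta> \<rho>) (\<lambda>\<rho> \<sigma>. \<gamma> \<rho> *\<^sub>C g \<rho> \<sigma>)"
proof -
  have "(\<gamma> \<rho> *\<^sub>C pm e + \<delta> \<rho> *\<^sub>C pn e) * (\<alpha> \<rho> *\<^sub>C pm e + \<beta> \<rho> *\<^sub>C pn e) =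
      (\<gamma> \<rho> * \<alpha> \<rho>) *\<^sub>C pm e + (\<delta> \<rho> * \<beta> \<rho>) *\<^sub>C pn e" for \<rho>
    by (simp add: distrib_left distrib_right scaleC_mult_left scaleC_mult_right scaleC_scaleC
        mult.commute)
  moreover have "(\<gamma> \<rho> *\<^sub>C pm e + \<delta> \<rho> *\<^sub>C pn e) * w_sandwich g h h' =
      (\<gamma> \<rho> *\<^sub>C w_sandwich g h h')" for \<rho> h h'
    by (simp add: w_sandwich_def distrib_right scaleC_mult_left flip: mult.assoc)
  moreover have "\<gamma> (lam h) *\<^sub>C w_sandwich g h h' = w_sandwich (\<lambda>\<rho> \<sigma>. \<gamma> \<rho> *\<^sub>C g \<rho> \<sigma>) h h'" for h h'
    by (simp add: w_sandwich_def scaleC_mult_left scaleC_mult_right)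
  ultimately show ?thesis
    unfolding second_matrix_def matrix_add_ldistrib diag_in_basis_mult diag_in_basis_mult_in_basis
    by simp
qed

text \<open>In the product the inner factors \<open>w j * star (w j)\<close> meet; grouped by the
  eigenvalue of \<open>j\<close> they add up to \<open>Q \<rho>\<close>. This is where the
  polynomials in the \<open>Q \<rho>\<close> come from.\<close>

lemma w_sandwich_mult:
  "(\<Sum>j\<in>{1..CARD('n \<times> 'm)}. w_sandwich (\<lambda>_ _. 1) h j * w_sandwich g j h') =
   w_sandwich (\<lambda>_ \<sigma>. \<Sum>\<rho>\<in>lam ` {1..CARD('n \<times> 'm)} - {0}. Q \<rho> * g \<rho> \<sigma>) h h'"
proof (cases "lam h \<noteq> 0 \<and> lam h' \<noteq> 0")
  case True
  let ?I = "{1..CARD('n \<times> 'm)}" and ?T = "lam ` {1..CARD('n \<times> 'm)} - {0}"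
  let ?F = "\<lambda>j. w j * star (w j) * g (lam j) (lam h')"
  have "(\<Sum>j\<in>?I. w_sandwich (\<lambda>_ _. 1) h j * w_sandwich g j h') =
      (\<Sum>j\<in>{j\<in>?I. lam j \<noteq> 0}. star (w h) * ?F j * w h')"
    using True by (intro sum.mono_neutral_cong_right) (auto simp: w_sandwich_def mult.assoc)
  also have "\<dots> = star (w h) * (\<Sum>j\<in>{j\<in>?I. lam j \<noteq> 0}. ?F j) * w h'"
    by (simp add: sum_distrib_left sum_distrib_right)
  also have "(\<Sum>j\<in>{j\<in>?I. lam j \<noteq> 0}. ?F j) =
      (\<Sum>\<rho>\<in>?T. \<Sum>j\<in>{j\<in>{j\<in>?I. lam j \<noteq> 0}. lam j = \<rho>}. ?F j)"
    by (rule sum.group[symmetric]) auto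
  also have "\<dots> = (\<Sum>\<rho>\<in>?T. Q \<rho> * g \<rho> (lam h'))"
  proof (rule sum.cong)
    fix \<rho> assume "\<rho> \<in> ?T"
    then have "{j\<in>{j\<in>?I. lam j \<noteq> 0}. lam j = \<rho>} = {j\<in>?I. lam j = \<rho>}" by auto
    then show "(\<Sum>j\<in>{j\<in>{j\<in>?I. lam j \<noteq> 0}. lam j = \<rho>}. ?F j) = Q \<rho> * g \<rho> (lam h')"
      by (simp add: Q_elem_def sum_distrib_right)
  qed simp
  finally show ?thesis using True by (simp add: w_sandwich_def)
qed (auto simp: w_sandwich_def)

text \<open>The diagonal part acts from the right on \<open>w h'\<close>, which keeps the
  coefficient of \<open>pm e\<close> and kills that of \<open>pn e\<close>; so
  \<open>\<alpha>\<close> is taken at the column eigenvalue \<open>\<sigma>\<close>. No diagonal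
  part survives, as every entry of the product is a sandwich.\<close>

lemma outer_f_mult_second_matrix:
  "outer (f_vec e v lam) ** second_matrix \<alpha> \<beta> g =
   second_matrix (\<lambda>_. 0) (\<lambda>_. 0)
     (\<lambda>_ \<sigma>. \<alpha> \<sigma> *\<^sub>C 1 + (\<Sum>\<rho>\<in>lam ` {1..CARD('n \<times> 'm)} - {0}. Q \<rho> * g \<rho> \<sigma>))"
proof -
  have "(\<Sum>j\<in>{1..CARD('n \<times> 'm)}. w_sandwich (\<lambda>_ _. 1) h j *
        (if j = h' then \<alpha> (lam j) *\<^sub>C pm e + \<beta> (lam j) *\<^sub>C pn e else 0)) =
      w_sandwich (\<lambda>_ \<sigma>. \<alpha> \<sigma> *\<^sub>C 1) h h'" if "h' \<in> {1..CARD('n \<times> 'm)}" for h h'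
  proof -
    have "(\<Sum>j\<in>{1..CARD('n \<times> 'm)}. w_sandwich (\<lambda>_ _. 1) h j *
          (if j = h' then \<alpha> (lam j) *\<^sub>C pm e + \<beta> (lam j) *\<^sub>C pn e else 0)) =
        (\<Sum>j\<in>{1..CARD('n \<times> 'm)}. if h' = j then w_sandwich (\<lambda>_ _. 1) h j *
          (\<alpha> (lam j) *\<^sub>C pm e + \<beta> (lam j) *\<^sub>C pn e) else 0)"
      by (intro sum.cong refl) auto
    then show ?thesis
      using that by (simp add: w_sandwich_def distrib_left mult.assoc scaleC_mult_left scaleC_mult_right)
  qed
  moreover have "w_sandwich (\<lambda>_ \<sigma>. \<alpha> \<sigma> *\<^sub>C 1) h h' + w_sandwich g' h h' =
      w_sandwich (\<lambda>\<rho> \<sigma>. \<alpha> \<sigma> *\<^sub>C 1 + g' \<rho> \<sigma>) h h'" for h h' g'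
    by (simp add: w_sandwich_def distrib_left distrib_right)
  ultimately show ?thesis
    unfolding second_matrix_def matrix_add_ldistrib outer_f
    unfolding diag_in_basis_def in_basis_mult in_basis_add w_sandwich_mult
    by (intro in_basis_cong) simp
qed

lemma second_algebra_form:
  assumes "X \<in> mat_alg ({outer (f_vec e v lam)} \<union> amalg_alg e C)"
  shows "\<exists>\<alpha> \<beta> g. (\<forall>\<rho> \<sigma>. g \<rho> \<sigma> \<in> Q_alg) \<and> X = second_matrix \<alpha> \<beta> g"
proof -
  let ?L = "{second_matrix \<alpha> \<beta> g | \<alpha> \<beta> g. \<forall>\<rho> \<sigma>. g \<rho> \<sigma> \<in> Q_alg}"
  have L: "second_matrix \<alpha> \<beta> g \<in> ?L" if "\<And>\<rho> \<sigma>. g \<rho> \<sigma> \<in> Q_alg" for \<alpha> \<beta> g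
    using that by blast
  \<comment> \<open>This lets \<open>1 \<otimes>\<^sub>m C\<close> and \<open>mat 1\<close> be
    written with coefficients on \<open>pm e\<close> and \<open>pn e\<close>.\<close>
  have unit: "pm e + pn e = 1"
    using units by (simp add: unital_matrix_units_def pm_def pn_def UNIV_Plus_UNIV[symmetric]
        sum.Plus del: UNIV_Plus_UNIV)
  have left: "diag_in_basis v (\<lambda>h. \<gamma> (lam h) *\<^sub>C pm e + \<delta> (lam h) *\<^sub>C pn e) ** Y \<in> ?L"
    if mem: "Y \<in> ?L" for \<gamma> \<delta> Y
  proof -
    obtain \<alpha> \<beta> g where "\<And>\<rho> \<sigma>. g \<rho> \<sigma> \<in> Q_alg" and Y: "Y = second_matrix \<alpha> \<beta> g"
      using mem by blast
    then show ?thesis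
      unfolding Y second_matrix_left by (intro L gen_alg.scl)
  qed
  have zero: "0 \<in> Q_alg" using alg_sum[of "{}"] by simp
  have "mat_alg ({outer (f_vec e v lam)} \<union> amalg_alg e C) \<subseteq> ?L"
  proof (rule mat_alg_amalg_subset)
    fix X Y assume X: "X \<in> {outer (f_vec e v lam)}" and "Y \<in> ?L"
    then obtain \<alpha> \<beta> g where g: "\<And>\<rho> \<sigma>. g \<rho> \<sigma> \<in> Q_alg" and Y: "Y = second_matrix \<alpha> \<beta> g" by blast
    have "\<alpha> \<sigma> *\<^sub>C 1 + (\<Sum>\<rho>\<in>lam ` {1..CARD('n \<times> 'm)} - {0}. Q \<rho> * g \<rho> \<sigma>) \<in> Q_alg" for \<sigma>
      by (intro gen_alg.add gen_alg.scl gen_alg.one alg_sum gen_alg.mul gen_alg.gen[OF imageI] g)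
    then show "X ** Y \<in> ?L"
      using X unfolding Y singleton_iff by (simp only: outer_f_mult_second_matrix) (rule L)
  next
    fix Y assume Y: "Y \<in> ?L"
    show "(pm e \<otimes>\<^sub>m mat 1) ** Y \<in> ?L"
      using left[OF Y, of "\<lambda>_. 1" "\<lambda>_. 0"] by (simp add: amalg_generators)
    show "(pn e \<otimes>\<^sub>m mat 1) ** Y \<in> ?L"
      using left[OF Y, of "\<lambda>_. 0" "\<lambda>_. 1"] by (simp add: amalg_generators)
    show "(1 \<otimes>\<^sub>m C) ** Y \<in> ?L"
      using left[OF Y, of of_real of_real]
      by (simp add: amalg_generators unit flip: scaleC_add_right)
  next
    have eq: "mat 1 = second_matrix (\<lambda>_. 1) (\<lambda>_. 1) (\<lambda>_ _. 0)"
      unfolding second_matrix_def mat_one_eq diag_in_basis_def in_basis_add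
      by (intro in_basis_cong) (simp add: w_sandwich_def unit)
    show "mat 1 \<in> ?L" unfolding eq by (intro L zero)
  next
    fix Y Z assume "Y \<in> ?L" "Z \<in> ?L"
    then obtain \<alpha> \<beta> g \<alpha>' \<beta>' g' where g: "\<And>\<rho> \<sigma>. g \<rho> \<sigma> \<in> Q_alg" "\<And>\<rho> \<sigma>. g' \<rho> \<sigma> \<in> Q_alg"
      and YZ: "Y = second_matrix \<alpha> \<beta> g" "Z = second_matrix \<alpha>' \<beta>' g'" by blast
    have eq: "Y + Z = second_matrix (\<lambda>\<rho>. \<alpha> \<rho> + \<alpha>' \<rho>) (\<lambda>\<rho>. \<beta> \<rho> + \<beta>' \<rho>) (\<lambda>\<rho> \<sigma>. g \<rho> \<sigma> + g' \<rho> \<sigma>)"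
      unfolding YZ second_matrix_def diag_in_basis_def in_basis_add
      by (intro in_basis_cong) (simp add: w_sandwich_def distrib_left distrib_right scaleC_add_left)
    show "Y + Z \<in> ?L" unfolding eq by (intro L gen_alg.add g)
  next
    fix c Y assume "Y \<in> ?L"
    then obtain \<alpha> \<beta> g where g: "\<And>\<rho> \<sigma>. g \<rho> \<sigma> \<in> Q_alg" and Y: "Y = second_matrix \<alpha> \<beta> g" by blast
    have eq: "mscale c Y = second_matrix (\<lambda>\<rho>. c * \<alpha> \<rho>) (\<lambda>\<rho>. c * \<beta> \<rho>) (\<lambda>\<rho> \<sigma>. c *\<^sub>C g \<rho> \<sigma>)"
      unfolding Y second_matrix_def diag_in_basis_def in_basis_add mscale_in_basis
      by (intro in_basis_cong)
        (simp add: w_sandwich_def scaleC_mult_left scaleC_mult_right scaleC_add_right scaleC_scaleC)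
    show "mscale c Y \<in> ?L" unfolding eq by (intro L gen_alg.scl g)
  qed
  then show ?thesis using assms by blast
qed

text \<open>
  Traciality turns \<open>\<tau>(w\<^sub>h\<^sup>* g w\<^sub>h\<^sub>')\<close> into \<open>\<tau>(w\<^sub>h\<^sub>' w\<^sub>h\<^sup>* g)\<close>, which tracial well-behavedness makes
  diagonal in \<open>h, h'\<close> and constant on eigenspaces.
\<close>

lemma psi_w_sandwich:
  assumes g: "\<And>\<rho> \<sigma>. g \<rho> \<sigma> \<in> Q_alg"
  shows "\<exists>\<kappa>. \<forall>h\<in>{1..CARD('n \<times> 'm)}. \<forall>h'\<in>{1..CARD('n \<times> 'm)}.
    psi \<tau> e (w_sandwich g h h') = (if h = h' then \<kappa> (lam h) *\<^sub>C pm e else 0)"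
proof -
  let ?I = "{1..CARD('n \<times> 'm)}"
  \<comment> \<open>A representative index for each eigenvalue, which makes \<open>\<kappa>\<close>
    a function of the eigenvalue alone.\<close>
  define r where "r = (\<lambda>\<rho>. SOME h. h \<in> ?I \<and> lam h = \<rho>)"
  have r: "r (lam h) \<in> ?I \<and> lam (r (lam h)) = lam h" if "h \<in> ?I" for h
    unfolding r_def by (rule someI[of _ h]) (use that in auto)
  define \<kappa> where "\<kappa> = (\<lambda>\<rho>. if \<rho> = 0 then 0 else
    inverse (\<tau> (pm e)) * \<tau> (w (r \<rho>) * star (w (r \<rho>)) * g \<rho> \<rho>))"
  have "psi \<tau> e (w_sandwich g h h') = (if h = h' then \<kappa> (lam h) *\<^sub>C pm e else 0)"
    if h: "h \<in> ?I" "h' \<in> ?I" for h h'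
  proof (cases "lam h \<noteq> 0 \<and> lam h' \<noteq> 0")
    case True
    let ?g = "g (lam h) (lam h')"
    have "\<tau> 0 = 0" using tracial_state_scaleC[OF tracial_state, of 0 0] by simp
    \<comment> \<open>The component along \<open>pn e\<close> vanishes because \<open>pn e\<close>
      annihilates \<open>star (w h)\<close>.\<close>
    then have "psi \<tau> e (star (w h) * ?g * w h') =
        (inverse (\<tau> (pm e)) * \<tau> (star (w h) * ?g * w h')) *\<^sub>C pm e"
      by (simp add: psi_def flip: mult.assoc)
    also have "\<tau> (star (w h) * ?g * w h') = \<tau> (w h' * star (w h) * ?g)"
      using tracial_state_commute[OF tracial_state] by (metis mult.assoc)
    also have "\<dots> = (if h' = h then \<tau> (w (r (lam h')) * star (w (r (lam h'))) * ?g) else 0)"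
      using r[OF h(2)] True by (intro trace_w_Q_alg g h) auto
    finally show ?thesis using True by (auto simp: w_sandwich_def \<kappa>_def)
  next
    case False
    then show ?thesis by (auto simp: w_sandwich_def \<kappa>_def psi_zero[OF tracial_state])
  qed
  then show ?thesis by blast
qed

lemma second_algebra_entries:
  assumes X: "X \<in> mat_alg ({outer (f_vec e v lam)} \<union> amalg_alg e C)"
    and E: "amalg_exp \<tau> e C X = 0"
  shows "X $ p $ q \<in> alg ({e i j | i j. True} \<union> alg {pm e, pn e})" "psi \<tau> e (X $ p $ q) = 0"
proof -
  define S where "S = {e i j | i j. True} \<union> alg {pm e, pn e}"
  obtain \<alpha> \<beta> g where g: "\<And>\<rho> \<sigma>. g \<rho> \<sigma> \<in> Q_alg" and X_eq: "X = second_matrix \<alpha> \<beta> g"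
    using second_algebra_form[OF X] by blast
  have zero: "0 \<in> alg S" using alg_sum[of "{}"] by simp
  have S: "{e i j | i j. True} \<subseteq> alg S" "pm e \<in> alg S" "pn e \<in> alg S"
    by (auto simp: S_def intro: gen_alg.gen)
  have w: "w s \<in> alg S" "star (w s) \<in> alg S" for s
    using w_in_alg[of s] S(1) by (auto intro: alg_mono)
  have "Q \<rho> \<in> alg S" for \<rho>
    unfolding Q_elem_def by (intro alg_sum gen_alg.mul w)
  then have gS: "g \<rho> \<sigma> \<in> alg S" for \<rho> \<sigma>
    by (intro alg_mono[OF g]) blast
  have sandwich: "w_sandwich g h h' \<in> alg S" for h h'
  proof (cases "lam h \<noteq> 0 \<and> lam h' \<noteq> 0")
    case True
    show ?thesis
      unfolding w_sandwich_def if_P[OF True] by (intro gen_alg.mul w gS)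
  next
    case False
    show ?thesis
      unfolding w_sandwich_def if_not_P[OF False] by (rule zero)
  qed
  have X_eq': "X = in_basis v (\<lambda>h h'. (if h = h' then \<alpha> (lam h) *\<^sub>C pm e + \<beta> (lam h) *\<^sub>C pn e else 0)
      + w_sandwich g h h')"
    unfolding X_eq second_matrix_def diag_in_basis_def in_basis_add ..
  show "X $ p $ q \<in> alg ({e i j | i j. True} \<union> alg {pm e, pn e})"
    unfolding X_eq' S_def[symmetric]
    by (intro in_basis_entry_alg gen_alg.add) (simp_all add: zero S sandwich gen_alg.add gen_alg.scl)
  obtain \<kappa> where \<kappa>: "\<And>h h'. h \<in> {1..CARD('n \<times> 'm)} \<Longrightarrow> h' \<in> {1..CARD('n \<times> 'm)} \<Longrightarrow>
    psi \<tau> e (w_sandwich g h h') = (if h = h' then \<kappa> (lam h) *\<^sub>C pm e else 0)"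
    using psi_w_sandwich[of g, OF g] by blast
  \<comment> \<open>The coefficients of \<open>psi\<close> on the diagonal entries. Sandwiches
    contribute \<open>\<kappa>\<close> to the coefficient of \<open>pm e\<close> only.\<close>
  define \<gamma> \<delta> where "\<gamma> = (\<lambda>\<rho>. inverse (\<tau> (pm e)) *
      \<tau> (pm e * (\<alpha> \<rho> *\<^sub>C pm e + \<beta> \<rho> *\<^sub>C pn e)) + \<kappa> \<rho>)"
    and "\<delta> = (\<lambda>\<rho>. inverse (\<tau> (pn e)) * \<tau> (pn e * (\<alpha> \<rho> *\<^sub>C pm e + \<beta> \<rho> *\<^sub>C pn e)))"
  have "tensor_id (psi \<tau> e) X = diag_in_basis v (\<lambda>h. \<gamma> (lam h) *\<^sub>C pm e + \<delta> (lam h) *\<^sub>C pn e)"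
    unfolding X_eq' diag_in_basis_def
      tensor_id_in_basis[of "psi \<tau> e", OF psi_add[OF tracial_state] psi_scaleC[OF tracial_state]]
  proof (rule in_basis_cong)
    fix h h' assume h: "h \<in> {1..CARD('n \<times> 'm)}" "h' \<in> {1..CARD('n \<times> 'm)}"
    show "psi \<tau> e ((if h = h' then \<alpha> (lam h) *\<^sub>C pm e + \<beta> (lam h) *\<^sub>C pn e else 0)
        + w_sandwich g h h') = (if h = h' then \<gamma> (lam h) *\<^sub>C pm e + \<delta> (lam h) *\<^sub>C pn e else 0)"
      unfolding psi_add[OF tracial_state] \<kappa>[OF h]
      by (simp add: psi_zero[OF tracial_state])
        (simp add: psi_def \<gamma>_def \<delta>_def scaleC_add_left add_ac)
  qed
  then show "psi \<tau> e (X $ p $ q) = 0"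
    by (rule amalg_exp_zero[OF E, of \<gamma> \<delta>])
qed

section \<open>Transfer of freeness to the matrices\<close>

text \<open>Centred factors have \<open>psi\<close>-centred entries in the two algebras assumed
  free, so every entry of an alternating product is killed by \<open>psi\<close>. The entrywise
  expectation of the product is then 0 before the second expectation is applied.\<close>

lemma mat_free_over_outer_f:
  assumes "free_over (psi \<tau> e) (alg {pm e, pn e}) {x} {e i j | i j. True}"
  shows "mat_free_over (amalg_exp \<tau> e C) (amalg_alg e C) {x \<otimes>\<^sub>m C} {outer (f_vec e v lam)}"
  unfolding mat_free_over_def free_amalg_def
proof (intro allI impI; elim conjE)
  let ?A1 = "mat_alg ({x \<otimes>\<^sub>m C} \<union> amalg_alg e C)"
  let ?A2 = "mat_alg ({outer (f_vec e v lam)} \<union> amalg_alg e C)"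
  fix Xs :: "(bool \<times> ('a^('n \<times> 'm)^('n \<times> 'm))) list"
  assume Xs: "Xs \<noteq> []" "distinct_adj (map fst Xs)"
    and all: "\<forall>(b, X)\<in>set Xs. X \<in> (if b then ?A1 else ?A2) \<and> amalg_exp \<tau> e C X = 0"
  have entries: "X $ p $ q \<in> (if b then alg ({x} \<union> alg {pm e, pn e})
      else alg ({e i j | i j. True} \<union> alg {pm e, pn e})) \<and> psi \<tau> e (X $ p $ q) = 0"
    if bX: "(b, X) \<in> set Xs" for b X p q
  proof -
    have mem: "X \<in> (if b then ?A1 else ?A2)" "amalg_exp \<tau> e C X = 0"
      using bspec[OF all bX] by simp_all
    show ?thesis
    proof (cases b)
      case True
      then have "X \<in> ?A1" using mem(1) by simp
      from first_algebra_entries[OF this mem(2)] show ?thesis unfolding if_P[OF True] by (rule conjI)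
    next
      case False
      then have "X \<in> ?A2" using mem(1) by simp
      from second_algebra_entries[OF this mem(2)] show ?thesis unfolding if_not_P[OF False] by (rule conjI)
    qed
  qed
  have "psi \<tau> e (foldr (**) (map snd Xs) (mat 1) $ p $ q) = 0" for p q
    using free_amalg_matrix_product[where Xs = Xs and ys = "[]" and g = "psi \<tau> e",
        OF assms[unfolded free_over_def] psi_add[OF tracial_state] entries] Xs
    by simp
  then have "tensor_id (psi \<tau> e) (foldr (**) (map snd Xs) (mat 1)) = 0"
    by (simp add: tensor_id_def vec_eq_iff)
  then show "amalg_exp \<tau> e C (foldr (**) (map snd Xs) (mat 1)) = 0"
    by (simp add: amalg_exp_def id_tensor_zero)
qed

end

theorem theorem4p5:
  fixes \<tau> :: "'a::cstar_algebra \<Rightarrow> complex"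
    and e :: "'m::finite + 'n::finite \<Rightarrow> 'm + 'n \<Rightarrow> 'a"
    and x :: 'a
    and \<phi> :: "complex^'m^'m \<Rightarrow> complex^'n^'n"
    and v :: "nat \<Rightarrow> complex^('n \<times> 'm)"
    and lam :: "nat \<Rightarrow> real"
  assumes "tracial_state \<tau>"
    and "unital_matrix_units e"
    and "\<And>i j. \<tau> (e i j) = (if i = j then 1 / of_nat (CARD('m) + CARD('n)) else 0)"
    and "star x = x"
    and "x = pm e * x * pm e"
    and "free_over (psi \<tau> e) (alg {pm e, pn e}) {x} {e i j | i j. True}"
    and "Vector_Spaces.linear mscale mscale \<phi>"
    and "hermiticity_preserving \<phi>"
    and "orthonormal_eigenbasis (choi \<phi>) v lam"
    and "tracially_well_behaved \<tau> e v lam"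
  shows "mat_free_over (amalg_exp \<tau> e (choi \<phi>)) (amalg_alg e (choi \<phi>))
           {x \<otimes>\<^sub>m choi \<phi>} {outer (f_vec e v lam)}"
proof -
  interpret choi_setting "choi \<phi>" v lam \<tau> e
    by unfold_locales (fact assms)+
  show ?thesis
    using assms(6) by (rule mat_free_over_outer_f)
qed

end
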